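(* Let $\mathbf{X}^*\succeq 0$ be an optimal solution of the problem $\min\{f(\mathbf{X}) : \mathbf{X}\succeq 0,\ \mathcal{A}(\mathbf{X})=\mathbf{b}\}$ and let $\mathbf{y}^*\in\mathbb{R}^m$ be a corresponding dual solution. Write $\nabla_{\mathbf{X}}\mathcal{L}^*:=\nabla_{\mathbf{X}}\mathcal{L}(\mathbf{X}^*,\mathbf{y}^* )=\nabla f(\mathbf{X}^* )-\mathcal{A}^\top(\mathbf{y}^* )$ and $\tilde r:=n-\mathrm{rank}(\nabla_{\mathbf{X}}\mathcal{L}^* )$. Let $\{(\mathbf{X}_t,\mathbf{y}_t)\}_{t\ge1}$ and $\{(\mathbf{Z}_t,\mathbf{w}_t)\}_{t\ge2}$ be the sequences generated by the extragradient method (defined in the context) with fixed step-size $\eta\le\frac{1}{\sqrt{2(\beta^2+\|\mathcal{A}\|^2)}}$. Fix $r\ge\tilde r$ and assume the initialization satisfies $\|(\mathbf{X}_1,\mathbf{y}_1)-(\mathbf{X}^*,\mathbf{y}^* )\|\le R_0(r)$, where $$R_0(r):=\frac{\eta\max\{\lambda_{n-r}(\nabla_{\mathbf{X}}\mathcal{L}^* ),\ \sqrt{\tilde r}\,\lambda_{n-r+\tilde r-1}(\nabla_{\mathbf{X}}\mathcal{L}^* )\}}{2(1+\sqrt2\,\eta\max\{\beta,\|\mathcal{A}\|\})}.$$ Then for all $t\ge1$ the projections $\Pi_{\mathbb{S}^n_+}[\cdot]$ in the extragradient method can be replaced with the rank-$r$ truncated projections $\widehat\Pi^r_{\mathbb{S}^n_+}[\cdot]$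 without changing the sequences $\{(\mathbf{X}_t,\mathbf{y}_t)\}_{t\ge1}$ and $\{(\mathbf{Z}_t,\mathbf{w}_t)\}_{t\ge2}$. Moreover, for all $T\ge1$, $$f\Big(\frac1T\sum_{t=1}^T\mathbf{Z}_{t+1}\Big)-f(\mathbf{X}^* )\le\frac{R^2}{2\eta T},\qquad \Big\|\mathcal{A}\Big(\frac1T\sum_{t=1}^T\mathbf{Z}_{t+1}\Big)-\mathbf{b}\Big\|_2\le\frac{R^2}{2\|\mathbf{y}^*\|_2\,\eta T},$$ where $R^2:=\|\mathbf{X}_1-\mathbf{X}^*\|_F^2+\max_{\mathbf{y}\in\mathbb{R}^m,\ \|\mathbf{y}\|_2\le2\|\mathbf{y}^*\|_2}\|\mathbf{y}_1-\mathbf{y}\|_2^2$. Furthermore, if the step-size is $\eta=\frac{1}{2\sqrt{\beta^2+\|\mathcal{A}\|^2}}$, then for all $T\ge1$, $$f(\mathbf{Z}_{T+1})-f(\mathbf{X}^* )\le\frac{R_1}{\eta\sqrt T},\qquad\|\mathcal{A}(\mathbf{Z}_{T+1})-\mathbf{b}\|_2\le\frac{R_1}{\|\mathbf{y}^*\|_2\,\eta\sqrt T},$$ where $R_1:=3\sqrt2\max\{2R_0(r),3\|\mathbf{y}^*\|_2\}\,\|(\mathbf{X}_1,\mathbf{y}_1)-(\mathbf{X}^*,\mathbf{y}^* )\|$.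
   Context: $\mathbb{S}^n$ is the space of $n\times n$ real symmetric matrices, $\mathbb{S}^n_+$ the positive semidefinite (PSD) ones, $\mathbb{S}^n_{++}$ the positive definite ones. Eigenvalues are ordered $\lambda_1(\cdot)\ge\dots\ge\lambda_n(\cdot)$. $f:\mathbb{S}^n\to\mathbb{R}$ is convex and $\beta$-smooth (its gradient is $\beta$-Lipschitz in Frobenius norm), $\mathbf{b}\in\mathbb{R}^m$, and $\mathcal{A}:\mathbb{S}^n\to\mathbb{R}^m$ is the linear map $\mathcal{A}(\mathbf{X})=(\langle\mathbf{X},\mathbf{A}_1\rangle,\dots,\langle\mathbf{X},\mathbf{A}_m\rangle)^\top$ with $\mathbf{A}_i\in\mathbb{S}^n$; $\mathcal{A}^\top(\mathbf{y})=\sum_i\mathbf{y}_i\mathbf{A}_i$ and $\|\mathcal{A}\|:=\max\{\|\mathcal{A}(\mathbf{X})\|_2:\|\mathbf{X}\|_F\le1\}$. Norms $\|(\cdot,\cdot)\|$ are Euclidean norms on the product space. Standing assumptions: there is $\bar{\mathbf{X}}\in\mathbb{S}^n_{++}$ with $\mathcal{A}(\bar{\mathbf{X}})=\mathbf{b}$ (Slater), and the problem $\min\{f(\mathbf{X}):\mathbf{X}\succeq0,\mathcal{A}(\mathbf{X})=\mathbf{b}\}$ is bounded from below. Lagrangian: $\mathcal{L}(\mathbf{X},\mathbf{y}):=f(\mathbf{X})+\mathbf{y}^\top(\mathbf{b}-\mathcal{A}(\mathbf{X}))$. A dual solution $\mathbf{y}^*$ corresponding to $\mathbf{X}^*$ is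 one for which $(\mathbf{X}^*,\mathbf{y}^* )$ is a saddle-point of $\min_{\mathbf{X}\succeq0}\max_{\mathbf{y}\in\mathbb{R}^m}\mathcal{L}(\mathbf{X},\mathbf{y})$. For $\mathbf{X}\in\mathbb{S}^n$ with eigen-decomposition $\mathbf{X}=\sum_{i=1}^n\lambda_i\mathbf{v}_i\mathbf{v}_i^\top$, $\lambda_1\ge\dots\ge\lambda_n$, the Euclidean projection onto the PSD cone is $\Pi_{\mathbb{S}^n_+}[\mathbf{X}]=\sum_{i=1}^n\max\{\lambda_i,0\}\mathbf{v}_i\mathbf{v}_i^\top$, and the rank-$r$ truncated projection is $\widehat\Pi^r_{\mathbb{S}^n_+}[\mathbf{X}]:=\sum_{i=1}^r\max\{\lambda_i,0\}\mathbf{v}_i\mathbf{v}_i^\top$. Extragradient method with step-size $\eta>0$: start from $(\mathbf{X}_1,\mathbf{y}_1)\in\mathbb{S}^n_+\times\mathbb{R}^m$ and for $t=1,2,\dots$ set $\mathbf{Z}_{t+1}=\Pi_{\mathbb{S}^n_+}[\mathbf{X}_t-\eta\nabla_{\mathbf{X}}\mathcal{L}(\mathbf{X}_t,\mathbf{y}_t)]$, $\mathbf{w}_{t+1}=\mathbf{y}_t+\eta\nabla_{\mathbf{y}}\mathcal{L}(\mathbf{X}_t,\mathbf{y}_t)$, $\mathbf{X}_{t+1}=\Pi_{\mathbb{S}^n_+}[\mathbf{X}_t-\eta\nabla_{\mathbf{X}}\mathcal{L}(\mathbf{Z}_{t+1},\mathbf{w}_{t+1})]$, $\mathbf{y}_{t+1}=\mathbf{y}_t+\eta\nabla_{\mathbf{y}}\mathcal{L}(\mathbf{Z}_{t+1},\mathbf{w}_{t+1})$.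 The rank parameter $r$ and $\tilde r$ are such that the eigenvalue indices appearing are in $\{1,\dots,n\}$. A bound with $\|\mathbf{y}^*\|_2$ in the denominator is vacuous if $\mathbf{y}^*=0$. *)

theory Defs
  imports "HOL-Analysis.Analysis"
begin

text \<open>
  Matrices are elements of \<open>real^'n^'n\<close>, so \<open>n\<close> is \<open>CARD('n)\<close> and \<open>m\<close> is \<open>CARD('m)\<close>. The inner
  product and norm of this type are the Frobenius ones, and the norm of the product type
  \<open>(real^'n^'n) \<times> (real^'m)\<close> is the Euclidean one.
\<close>

definition sym_mats :: "(real^'n^'n) set" where
  "sym_mats = {X. transpose X = X}"

definition psd_mats :: "(real^'n^'n) set" where
  "psd_mats = {X \<in> sym_mats. \<forall>u. 0 \<le> u \<bullet> (X *v u)}"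

definition pd_mats :: "(real^'n^'n) set" where
  "pd_mats = {X \<in> sym_mats. \<forall>u. u \<noteq> 0 \<longrightarrow> 0 < u \<bullet> (X *v u)}"

definition outer :: "real^'n \<Rightarrow> real^'n^'n" where
  "outer v = (\<chi> i j. v $ i * v $ j)"

text \<open>
  Eigenvalues and eigenvectors are indexed by the natural numbers \<open>1, \<dots>, n\<close>; values at other
  indices are irrelevant.
\<close>

definition eigen_decomp :: "real^'n^'n \<Rightarrow> (nat \<Rightarrow> real) \<Rightarrow> (nat \<Rightarrow> real^'n) \<Rightarrow> bool" where
  "eigen_decomp X lam v \<longleftrightarrow>
     (\<forall>i\<in>{1..CARD('n)}. \<forall>j\<in>{1..CARD('n)}. v i \<bullet> v j = (if i = j then 1 else 0)) \<and>
     (\<forall>i\<in>{1..CARD('n)}. \<forall>j\<in>{1..CARD('n)}. i \<le> j \<longrightarrow> lam j \<le> lam i) \<and>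
     X = (\<Sum>i=1..CARD('n). lam i *\<^sub>R outer (v i))"

definition eigval :: "real^'n^'n \<Rightarrow> nat \<Rightarrow> real" where
  "eigval X i = (THE \<mu>. \<exists>lam v. eigen_decomp X lam v \<and> \<mu> = lam i)"

definition psd_proj :: "real^'n^'n \<Rightarrow> real^'n^'n \<Rightarrow> bool" where
  "psd_proj X Y \<longleftrightarrow> Y = closest_point psd_mats X"

text \<open>
  The truncated projection depends on the chosen eigen-decomposition if the \<open>r\<close>-th and
  \<open>(r+1)\<close>-st eigenvalues coincide and are positive. It is therefore a relation: \<open>Y\<close> is a
  truncated projection of \<open>X\<close> if it arises from some eigen-decomposition. The exact
  projection is a relation as well, to be used in the same places.
\<close>

definition trunc_psd_proj :: "nat \<Rightarrow> real^'n^'n \<Rightarrow> real^'n^'n \<Rightarrow> bool" where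
  "trunc_psd_proj r X Y \<longleftrightarrow>
     (\<exists>lam v. eigen_decomp X lam v \<and> Y = (\<Sum>i=1..r. max (lam i) 0 *\<^sub>R outer (v i)))"

text \<open>
  Gradient of a function on a linear subspace \<open>S\<close>, as an element of \<open>S\<close>. Values of the function
  outside \<open>S\<close> play no role; a function on symmetric matrices is represented by any extension.
\<close>

definition grad_on :: "'a::euclidean_space set \<Rightarrow> ('a \<Rightarrow> real) \<Rightarrow> 'a \<Rightarrow> 'a" where
  "grad_on S g x = (THE d. d \<in> S \<and> (g has_derivative (\<lambda>h. d \<bullet> h)) (at x within S))"

definition smooth_on :: "real \<Rightarrow> 'a::euclidean_space set \<Rightarrow> ('a \<Rightarrow> real) \<Rightarrow> bool" where
  "smooth_on \<beta> S g \<longleftrightarrow> g differentiable_on S \<and> \<beta>-lipschitz_on S (grad_on S g)"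

definition lin_map :: "('m::finite \<Rightarrow> real^'n^'n) \<Rightarrow> real^'n^'n \<Rightarrow> real^'m" where
  "lin_map A X = (\<chi> i. X \<bullet> A i)"

definition lin_map_adj :: "('m::finite \<Rightarrow> real^'n^'n) \<Rightarrow> real^'m \<Rightarrow> real^'n^'n" where
  "lin_map_adj A y = (\<Sum>i\<in>UNIV. y $ i *\<^sub>R A i)"

definition lin_map_norm :: "('m::finite \<Rightarrow> real^'n^'n) \<Rightarrow> real" where
  "lin_map_norm A = (SUP X\<in>{X \<in> sym_mats. norm X \<le> 1}. norm (lin_map A X))"

definition feasible :: "('m::finite \<Rightarrow> real^'n^'n) \<Rightarrow> real^'m \<Rightarrow> (real^'n^'n) set" where
  "feasible A b = {X \<in> psd_mats. lin_map A X = b}"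

definition lagrangian ::
    "(real^'n^'n \<Rightarrow> real) \<Rightarrow> ('m::finite \<Rightarrow> real^'n^'n) \<Rightarrow> real^'m \<Rightarrow> real^'n^'n \<Rightarrow> real^'m \<Rightarrow> real" where
  "lagrangian f A b X y = f X + y \<bullet> (b - lin_map A X)"

definition saddle_point ::
    "(real^'n^'n \<Rightarrow> real) \<Rightarrow> ('m::finite \<Rightarrow> real^'n^'n) \<Rightarrow> real^'m \<Rightarrow> real^'n^'n \<Rightarrow> real^'m \<Rightarrow> bool" where
  "saddle_point f A b Xs ys \<longleftrightarrow> Xs \<in> psd_mats \<and>
     (\<forall>y. lagrangian f A b Xs y \<le> lagrangian f A b Xs ys) \<and>
     (\<forall>X\<in>psd_mats. lagrangian f A b Xs ys \<le> lagrangian f A b X ys)"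

definition grad_X ::
    "(real^'n^'n \<Rightarrow> real) \<Rightarrow> ('m::finite \<Rightarrow> real^'n^'n) \<Rightarrow> real^'m \<Rightarrow> real^'n^'n \<Rightarrow> real^'m \<Rightarrow> real^'n^'n" where
  "grad_X f A b X y = grad_on sym_mats (\<lambda>X'. lagrangian f A b X' y) X"

definition grad_y ::
    "(real^'n^'n \<Rightarrow> real) \<Rightarrow> ('m::finite \<Rightarrow> real^'n^'n) \<Rightarrow> real^'m \<Rightarrow> real^'n^'n \<Rightarrow> real^'m \<Rightarrow> real^'m" where
  "grad_y f A b X y = grad_on UNIV (\<lambda>y'. lagrangian f A b X y') y"

text \<open>
  \<open>P\<close> is the (relational) projection in use. The sequences \<open>X, y\<close> matter from index \<open>1\<close> on,
  the sequences \<open>Z, w\<close> from index \<open>2\<close> on.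
\<close>

definition extragradient ::
    "(real^'n^'n \<Rightarrow> real^'n^'n \<Rightarrow> bool) \<Rightarrow>
     (real^'n^'n \<Rightarrow> real) \<Rightarrow> ('m::finite \<Rightarrow> real^'n^'n) \<Rightarrow> real^'m \<Rightarrow> real \<Rightarrow>
     (nat \<Rightarrow> real^'n^'n) \<Rightarrow> (nat \<Rightarrow> real^'m) \<Rightarrow> (nat \<Rightarrow> real^'n^'n) \<Rightarrow> (nat \<Rightarrow> real^'m) \<Rightarrow> bool" where
  "extragradient P f A b \<eta> X y Z w \<longleftrightarrow> X 1 \<in> psd_mats \<and>
     (\<forall>t\<ge>1. P (X t - \<eta> *\<^sub>R grad_X f A b (X t) (y t)) (Z (t + 1)) \<and>
            w (t + 1) = y t + \<eta> *\<^sub>R grad_y f A b (X t) (y t) \<and>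
            P (X t - \<eta> *\<^sub>R grad_X f A b (Z (t + 1)) (w (t + 1))) (X (t + 1)) \<and>
            y (t + 1) = y t + \<eta> *\<^sub>R grad_y f A b (Z (t + 1)) (w (t + 1)))"


lemma subspace_sym_mats: "subspace (sym_mats :: (real^'n^'n) set)"
  by (auto simp: subspace_def sym_mats_def transpose_def vec_eq_iff)

lemma grad_on_unique:
  assumes S: "subspace S" and x: "x \<in> S"
    and d: "d \<in> S" "(g has_derivative (\<lambda>h. d \<bullet> h)) (at x within S)"
    and e: "e \<in> S" "(g has_derivative (\<lambda>h. e \<bullet> h)) (at x within S)"
  shows "d = e"
proof -
  let ?u = "d - e"
  have u: "?u \<in> S" using S d e by (simp add: subspace_diff)
  have der: "((\<lambda>y. 0) has_derivative (\<lambda>h. ?u \<bullet> h)) (at x within S)"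
    using has_derivative_diff[OF d(2) e(2)] by (simp add: inner_diff_left)
  have line: "((\<lambda>t::real. x + t *\<^sub>R ?u) has_derivative (\<lambda>t. t *\<^sub>R ?u)) (at 0)"
    by (auto intro!: derivative_eq_intros)
  have sub: "range (\<lambda>t::real. x + t *\<^sub>R ?u) \<subseteq> S"
    using S x u by (auto intro: subspace_add subspace_scale)
  have "((\<lambda>t::real. 0::real) has_derivative (\<lambda>t. ?u \<bullet> (t *\<^sub>R ?u))) (at 0)"
    using has_derivative_compose[OF line, of "\<lambda>y. 0" "\<lambda>h. ?u \<bullet> h"]
      has_derivative_in_compose[OF line has_derivative_subset[OF _ sub], of "\<lambda>y. 0" "\<lambda>h. ?u \<bullet> h"] der
    by simp
  from has_derivative_unique[OF this has_derivative_const]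
  have "?u \<bullet> (1 *\<^sub>R ?u) = 0" by metis
  thus ?thesis by simp
qed

lemma grad_on_eqI:
  assumes "subspace S" "x \<in> S" "d \<in> S" "(g has_derivative (\<lambda>h. d \<bullet> h)) (at x within S)"
  shows "grad_on S g x = d"
  unfolding grad_on_def using assms grad_on_unique[OF assms(1,2)] by (intro the_equality) auto

lemma grad_on_works:
  assumes S: "subspace S" and x: "x \<in> S" and g: "g differentiable (at x within S)"
  shows "grad_on S g x \<in> S" "(g has_derivative (\<lambda>h. grad_on S g x \<bullet> h)) (at x within S)"
proof -
  from g obtain g' where g': "(g has_derivative g') (at x within S)"
    by (auto simp: differentiable_def)
  define D where "D = adjoint g' 1"
  have lin: "linear g'" using g' by (rule has_derivative_linear)
  have D: "g' h = D \<bullet> h" for h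
    using adjoint_works[OF lin, of h 1] by (simp add: D_def inner_commute)
  obtain d e where de: "d \<in> span S" "\<And>w. w \<in> span S \<Longrightarrow> orthogonal e w" "D = d + e"
    using orthogonal_subspace_decomp_exists[of S D] by metis
  have dS: "d \<in> S" using de(1) S by (metis span_eq_iff)
  have eq: "g' (y - x) = d \<bullet> (y - x)" if "y \<in> S" for y
    using de(2)[OF span_base[OF subspace_diff[OF S that x]]]
    by (simp add: D de(3) inner_add_left orthogonal_def)
  have "(g has_derivative (\<lambda>h. d \<bullet> h)) (at x within S)"
    using g' unfolding has_derivative_within
    by (auto intro!: bounded_linear_inner_right simp: eq elim!: Lim_transform_eventually
        simp: eventually_at_filter)
  with dS show "grad_on S g x \<in> S" "(g has_derivative (\<lambda>h. grad_on S g x \<bullet> h)) (at x within S)"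
    using grad_on_eqI[OF S x] by metis+
qed

lemma inner_lin_map: "y \<bullet> lin_map A X = lin_map_adj A y \<bullet> X"
  by (simp add: lin_map_def lin_map_adj_def inner_vec_def[of y] inner_sum_left inner_commute[of X])

lemma grad_X_eq:
  assumes A: "\<And>i. A i \<in> sym_mats" and f: "f differentiable_on sym_mats" and X: "X \<in> sym_mats"
  shows "grad_X f A b X y = grad_on sym_mats f X - lin_map_adj A y"
proof -
  have adj: "lin_map_adj A y \<in> sym_mats"
    unfolding lin_map_adj_def by (intro subspace_sum subspace_scale subspace_sym_mats A)
  note gf = grad_on_works[OF subspace_sym_mats X, of f]
  have fd: "f differentiable (at X within sym_mats)" using f X by (simp add: differentiable_on_def)
  have "((\<lambda>X'. f X' + (y \<bullet> b - lin_map_adj A y \<bullet> X')) has_derivative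
         (\<lambda>h. grad_on sym_mats f X \<bullet> h + (0 - lin_map_adj A y \<bullet> h))) (at X within sym_mats)"
    by (intro has_derivative_add has_derivative_diff has_derivative_const gf(2)[OF fd]
        bounded_linear_imp_has_derivative bounded_linear_inner_right)
  hence "((\<lambda>X'. lagrangian f A b X' y) has_derivative
         (\<lambda>h. (grad_on sym_mats f X - lin_map_adj A y) \<bullet> h)) (at X within sym_mats)"
    by (simp add: lagrangian_def inner_diff_right inner_diff_left inner_lin_map)
  thus ?thesis
    unfolding grad_X_def using gf(1)[OF fd] adj
    by (intro grad_on_eqI subspace_sym_mats X subspace_diff)
qed

lemma grad_y_eq: "grad_y f A b X y = b - lin_map A X"
  unfolding grad_y_def lagrangian_def
  by (rule grad_on_eqI) (auto intro!: derivative_eq_intros simp: inner_commute)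

end

theory Submission
  imports Defs
begin

text \<open>
  After scaling by \<open>\<eta>\<close>, the saddle operator \<open>F(X, y) = (\<nabla>f(X) - A\<^sup>Ty, A(X) - b)\<close> is monotone and
  \<open>L\<close>-Lipschitz with \<open>L = \<eta> \<surd>(2(\<beta>\<^sup>2 + \<parallel>A\<parallel>\<^sup>2)) \<le> 1\<close>, so the extragradient iterates are Fejer monotone with
  respect to the saddle point and the half steps stay within twice the initial distance. The matrices
  to be projected therefore have the form \<open>X\<^sup>* - \<eta>G + E\<close> with \<open>G = \<nabla>\<^sub>X\<L>\<^sup>*\<close> and \<open>E\<close> small. As \<open>X\<^sup>*\<close> and \<open>G\<close> are
  complementary, the quadratic form of \<open>X\<^sup>* - \<eta>G\<close> is at most \<open>-\<eta>\<lambda>\<^sub>k(G)\<close> on the span of the top \<open>k\<close>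
  eigenvectors of \<open>G\<close>; if the \<open>(r+1)\<close>-st eigenvalue of the perturbed matrix were positive, then the form of
  \<open>E\<close> would exceed \<open>\<eta>\<lambda>\<^sub>k(G)\<close> on a space of dimension \<open>s = k + r + 1 - n\<close>, whence
  \<open>\<parallel>E\<parallel> > \<eta> \<surd>s \<lambda>\<^sub>k(G)\<close>. The two terms of \<open>R\<^sub>0\<close> are the cases \<open>s = 1\<close> and \<open>s = n - rank G\<close>.

  The ergodic rate is the telescoped energy inequality. For the last iterate, the residual
  \<open>F(z\<^sub>t\<^sub>+\<^sub>1) + c\<^sub>t\<^sub>+\<^sub>1\<close>, with \<open>c\<^sub>t\<^sub>+\<^sub>1\<close> the normal vector produced by the projection, has nonincreasing norm,
  bounded by a multiple of the step \<open>\<parallel>z\<^sub>t - u\<^sub>t\<^sub>+\<^sub>1\<parallel>\<close>, and these steps are square summable.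
\<close>

subsection \<open>The extragradient method for monotone Lipschitz operators\<close>

text \<open>The variational characterisation of the Euclidean projection, as a relation:
  \<open>x - p\<close> is a normal vector of \<open>K\<close> at \<open>p\<close>. It makes sense in
  any inner product space, without an existence result.\<close>

definition is_proj :: "'a::real_inner set \<Rightarrow> 'a \<Rightarrow> 'a \<Rightarrow> bool" where
  "is_proj K x p \<longleftrightarrow> p \<in> K \<and> (\<forall>q\<in>K. (x - p) \<bullet> (q - p) \<le> 0)"

text \<open>Each variational inequality is tested at the other projection; their sum bounds the
  squared distance by an inner product, and Cauchy-Schwarz finishes. With \<open>x = y\<close> this
  is uniqueness of projections.\<close>

lemma is_proj_nonexpansive:
  assumes "is_proj K x p" "is_proj K y q"
  shows "norm (p - q) \<le> norm (x - y)"
proof -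
  have "(x - p) \<bullet> (q - p) \<le> 0" "(y - q) \<bullet> (p - q) \<le> 0"
    using assms by (auto simp: is_proj_def)
  hence "(norm (p - q))\<^sup>2 \<le> (x - y) \<bullet> (p - q)"
    by (simp add: power2_norm_eq_inner inner_simps inner_commute)
  also have "\<dots> \<le> norm (x - y) * norm (p - q)" by (rule norm_cauchy_schwarz)
  finally show ?thesis by (cases "p = q") (auto simp: power2_eq_square)
qed

text \<open>The step-size is absorbed into \<open>F\<close>, so steps have the form
  \<open>z - F z\<close> and the step-size condition becomes \<open>L \<le> 1\<close>.\<close>

locale monotone_lipschitz =
  fixes K :: "'a::real_inner set" and F :: "'a \<Rightarrow> 'a" and L :: real
  assumes mono: "\<And>x y. x \<in> K \<Longrightarrow> y \<in> K \<Longrightarrow> 0 \<le> (F x - F y) \<bullet> (x - y)"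
    and lip: "\<And>x y. x \<in> K \<Longrightarrow> y \<in> K \<Longrightarrow> norm (F x - F y) \<le> L * norm (x - y)"
    and L_nonneg: "0 \<le> L" and L_le_1: "L \<le> 1"
begin

section \<open>Inequalities for a single extragradient step\<close>

lemma lip_power2:
  assumes "x \<in> K" "y \<in> K"
  shows "(norm (F x - F y))\<^sup>2 \<le> L\<^sup>2 * (norm (x - y))\<^sup>2"
  using power_mono[OF lip[OF assms] norm_ge_zero, of 2] by (simp add: power_mult_distrib)

text \<open>The inequality for \<open>z'\<close> is tested at \<open>q\<close> and the one for
  \<open>u\<close> at \<open>z'\<close>. What remains is the cross term of \<open>F z - F u\<close>
  with \<open>z' - u\<close>, which Young's inequality (fact 3) and the Lipschitz bound turn into
  \<open>L\<^sup>2\<close> times the squared step.\<close>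

lemma step_energy:
  assumes z: "z \<in> K" and u: "is_proj K (z - F z) u" and z': "is_proj K (z - F u) z'" and q: "q \<in> K"
  shows "(norm (z' - q))\<^sup>2 + (1 - L\<^sup>2) * (norm (z - u))\<^sup>2 + 2 * (F u \<bullet> (u - q)) \<le> (norm (z - q))\<^sup>2"
proof -
  have K: "u \<in> K" "z' \<in> K" using u z' by (auto simp: is_proj_def)
  have 1: "(z - F u - z') \<bullet> (q - z') \<le> 0" using z' q by (auto simp: is_proj_def)
  have 2: "(z - F z - u) \<bullet> (z' - u) \<le> 0" using u K by (auto simp: is_proj_def)
  have 3: "0 \<le> (norm ((F z - F u) - (z' - u)))\<^sup>2" by simp
  have 4: "(norm (F z - F u))\<^sup>2 \<le> L\<^sup>2 * (norm (z - u))\<^sup>2" by (rule lip_power2[OF z K(1)])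
  show ?thesis using 1 2 3 4 unfolding left_diff_distrib mult_1
    by (simp add: power2_norm_eq_inner inner_simps inner_commute)
qed

text \<open>\<open>c\<close> is any normal vector of \<open>K\<close> at \<open>z\<close>, so
  \<open>F z + c\<close> measures how far \<open>z\<close> is from solving the variational
  inequality. The vector \<open>z - F u - z'\<close> is again normal, at \<open>z'\<close>, so the
  estimate can be iterated.\<close>

lemma step_residual_antimono:
  assumes z: "z \<in> K" and c: "\<And>q. q \<in> K \<Longrightarrow> c \<bullet> (q - z) \<le> 0"
    and u: "is_proj K (z - F z) u" and z': "is_proj K (z - F u) z'"
  shows "norm (F z' + (z - F u - z')) \<le> norm (F z + c)"
proof -
  define d where "d = z - F z - u"
  define c' where "c' = z - F u - z'"
  have K: "u \<in> K" "z' \<in> K" using u z' by (auto simp: is_proj_def)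
  \<comment> \<open>Differences of iterates are rewritten through operator values and normal
    vectors, so that every fact below is quadratic in \<open>F z\<close>, \<open>F u\<close>,
    \<open>F z'\<close>, \<open>c\<close>, \<open>c'\<close> and \<open>d\<close>.\<close>
  have zu: "z - u = F z + d" and zz': "z - z' = F u + c'" by (auto simp: d_def c'_def)
  hence uz': "z' - u = F z + d - F u - c'" and uz'': "u - z' = F u + c' - F z - d"
    by (auto simp: algebra_simps)
  have "0 \<le> (F z - F z') \<bullet> (z - z')" by (rule mono[OF z K(2)])
  hence 1: "0 \<le> (F z - F z') \<bullet> (F u + c')" unfolding zz' .
  have "(norm (F z' - F u))\<^sup>2 \<le> L\<^sup>2 * (norm (z' - u))\<^sup>2" by (rule lip_power2[OF K(2,1)])
  also have "\<dots> \<le> 1 * (norm (z' - u))\<^sup>2"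
    using L_nonneg L_le_1 by (intro mult_right_mono) (auto simp: power_le_one)
  finally have 2: "(norm (F z' - F u))\<^sup>2 \<le> (norm (F z + d - F u - c'))\<^sup>2" by (simp add: uz')
  have "c' \<bullet> (z - z') \<le> 0" using z' z by (auto simp: is_proj_def c'_def)
  hence 3: "c' \<bullet> (F u + c') \<le> 0" unfolding zz' .
  have "d \<bullet> (z' - u) \<le> 0" using u K by (auto simp: is_proj_def d_def)
  hence 4: "d \<bullet> (F z + d - F u - c') \<le> 0" unfolding uz' .
  have "0 \<le> c \<bullet> (z - u)" using c[OF K(1)] by (simp add: inner_diff_right)
  hence 5: "0 \<le> c \<bullet> (F z + d)" unfolding zu .
  have 6: "0 \<le> (norm (c - d))\<^sup>2" by simp
  \<comment> \<open>twice each of 1, 3, 4, 5 plus 2 and 6, up to signs, adds up to exactly the claim\<close>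
  have "(norm (F z' + c'))\<^sup>2 \<le> (norm (F z + c))\<^sup>2"
    using 1 2 3 4 5 6 by (simp add: power2_norm_eq_inner inner_simps inner_commute)
  thus ?thesis unfolding c'_def by (rule power2_le_imp_le) simp
qed

text \<open>As \<open>c\<close> is normal at \<open>z\<close>, the point \<open>z\<close> is itself
  the projection of \<open>z + c\<close>; it is compared with \<open>u\<close>, the projection of
  \<open>z - F z\<close>.\<close>

lemma step_le_residual:
  assumes z: "z \<in> K" and c: "\<And>q. q \<in> K \<Longrightarrow> c \<bullet> (q - z) \<le> 0" and u: "is_proj K (z - F z) u"
  shows "norm (z - u) \<le> norm (F z + c)"
proof -
  have "is_proj K (z + c) z" using z c by (auto simp: is_proj_def)
  from is_proj_nonexpansive[OF this u] show ?thesis by (simp add: add.commute)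
qed

text \<open>The residual splits into \<open>F z' - F u\<close>, \<open>z - u\<close> and
  \<open>u - z'\<close>. Nonexpansiveness makes the last at most \<open>L\<close> times the step,
  hence the first at most \<open>L\<^sup>2\<close> times the step.\<close>

lemma residual_le_step:
  assumes z: "z \<in> K" and u: "is_proj K (z - F z) u" and z': "is_proj K (z - F u) z'"
  shows "norm (F z' + (z - F u - z')) \<le> (1 + L + L\<^sup>2) * norm (z - u)"
proof -
  have K: "u \<in> K" "z' \<in> K" using u z' by (auto simp: is_proj_def)
  have uz': "norm (u - z') \<le> L * norm (z - u)"
    using is_proj_nonexpansive[OF u z'] lip[OF K(1) z] by (simp add: norm_minus_commute)
  have "norm (F z' + (z - F u - z')) = norm ((F z' - F u) + ((z - u) + (u - z')))"
    by (simp add: algebra_simps)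
  also have "\<dots> \<le> norm (F z' - F u) + (norm (z - u) + norm (u - z'))"
    by (meson norm_triangle_ineq norm_triangle_mono order_refl)
  also have "norm (F z' - F u) \<le> L * (L * norm (z - u))"
    using lip[OF K(2,1)] mult_left_mono[OF uz' L_nonneg] by (simp add: norm_minus_commute)
  finally show ?thesis using uz' by (simp add: algebra_simps power2_eq_square)
qed

text \<open>The vector equals \<open>(z - u) - (F z - F u)\<close>; expanding its square,
  monotonicity gives the cross term a favourable sign.\<close>

lemma half_step_residual:
  assumes z: "z \<in> K" and u: "is_proj K (z - F z) u"
  shows "(norm (F u + (z - F z - u)))\<^sup>2 \<le> (1 + L\<^sup>2) * (norm (z - u))\<^sup>2"
proof -
  have K: "u \<in> K" using u by (auto simp: is_proj_def)
  have 1: "0 \<le> (F z - F u) \<bullet> (z - u)" by (rule mono[OF z K])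
  have 2: "(norm (F z - F u))\<^sup>2 \<le> L\<^sup>2 * (norm (z - u))\<^sup>2" by (rule lip_power2[OF z K])
  show ?thesis using 1 2 unfolding distrib_right mult_1
    by (simp add: power2_norm_eq_inner inner_simps inner_commute)
qed

text \<open>A solution \<open>s\<close> is the projection of \<open>s - F s\<close>, so
  nonexpansiveness compares \<open>u\<close> with it, and monotonicity signs the cross term of the
  expanded square.\<close>

lemma half_step_dist_solution:
  assumes z: "z \<in> K" and u: "is_proj K (z - F z) u"
    and s: "s \<in> K" "\<And>q. q \<in> K \<Longrightarrow> 0 \<le> F s \<bullet> (q - s)"
  shows "(norm (u - s))\<^sup>2 \<le> (1 + L\<^sup>2) * (norm (z - s))\<^sup>2"
proof -
  have "is_proj K (s - F s) s" using s by (auto simp: is_proj_def)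
  from power_mono[OF is_proj_nonexpansive[OF u this] norm_ge_zero, of 2]
  have 1: "(norm (u - s))\<^sup>2 \<le> (norm (z - F z - (s - F s)))\<^sup>2" .
  have 2: "0 \<le> (F z - F s) \<bullet> (z - s)" by (rule mono[OF z s(1)])
  have 3: "(norm (F z - F s))\<^sup>2 \<le> L\<^sup>2 * (norm (z - s))\<^sup>2" by (rule lip_power2[OF z s(1)])
  have "(norm (z - F z - (s - F s)))\<^sup>2 = (norm (z - s))\<^sup>2 - 2 * ((F z - F s) \<bullet> (z - s)) + (norm (F z - F s))\<^sup>2"
    by (simp add: power2_norm_eq_inner inner_simps inner_commute)
  with 1 2 3 show ?thesis by (simp add: distrib_right)
qed

end

section \<open>Complete runs of the method\<close>

locale extragradient_run = monotone_lipschitz K F L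
  for K :: "'a::real_inner set" and F :: "'a \<Rightarrow> 'a" and L :: real +
  fixes z u :: "nat \<Rightarrow> 'a"
  assumes z1: "z 1 \<in> K"
    and u_step: "\<And>t. 1 \<le> t \<Longrightarrow> is_proj K (z t - F (z t)) (u (t + 1))"
    and z_step: "\<And>t. 1 \<le> t \<Longrightarrow> is_proj K (z t - F (u (t + 1))) (z (t + 1))"
begin

lemma u_in: "1 \<le> t \<Longrightarrow> u (t + 1) \<in> K"
  using u_step by (auto simp: is_proj_def)

lemma z_in: "1 \<le> t \<Longrightarrow> z t \<in> K"
  by (induction t rule: dec_induct) (use z1 z_step in \<open>auto simp: is_proj_def\<close>)

lemma energy:
  assumes q: "q \<in> K"
  shows "(norm (z (T + 1) - q))\<^sup>2 + (1 - L\<^sup>2) * (\<Sum>t=1..T. (norm (z t - u (t + 1)))\<^sup>2)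
           + 2 * (\<Sum>t=1..T. F (u (t + 1)) \<bullet> (u (t + 1) - q)) \<le> (norm (z 1 - q))\<^sup>2"
proof (induction T)
  case (Suc T)
  thus ?case
    using step_energy[OF z_in u_step z_step q, of "T + 1"] by (simp add: algebra_simps)
qed simp

text \<open>The index is that of the step taken: \<open>residual t\<close> belongs to the iterate
  \<open>z (t + 1)\<close>, since its normal vector is produced by the projection onto that
  iterate.\<close>

definition residual :: "nat \<Rightarrow> 'a" where
  "residual t = F (z (t + 1)) + (z t - F (u (t + 1)) - z (t + 1))"

lemma residual_antimono:
  assumes "1 \<le> s" "s \<le> t"
  shows "norm (residual t) \<le> norm (residual s)"
  using assms(2)
proof (induction t rule: dec_induct)
  case (step t)
  have "norm (residual (t + 1)) \<le> norm (residual t)"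
    using z_step[of t] step assms(1) unfolding residual_def
    by (intro step_residual_antimono z_in u_step z_step) (auto simp: is_proj_def)
  with step show ?case by simp
qed simp

text \<open>Steps need not decrease, but residuals do: a step is at most the residual at its
  starting point, which is at most an earlier residual, which is at most a constant times the
  earlier step. The shifted index of \<open>residual\<close> forces the separate case
  \<open>s = t\<close>.\<close>

lemma step_le_step:
  assumes "1 \<le> s" "s \<le> t"
  shows "norm (z t - u (t + 1)) \<le> (1 + L + L\<^sup>2) * norm (z s - u (s + 1))"
proof (cases "s = t")
  case True
  thus ?thesis using mult_right_mono[of 1 "1 + L + L\<^sup>2" "norm (z t - u (t + 1))"] L_nonneg by simp
next
  case False
  then obtain t' where t': "t = t' + 1" "s \<le> t'" using assms by (cases t) auto
  have "norm (z t - u (t + 1)) \<le> norm (residual t')"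
    using z_step[of t'] assms t' unfolding residual_def t'(1)
    by (intro step_le_residual z_in u_step) (auto simp: is_proj_def)
  also have "\<dots> \<le> norm (residual s)" by (rule residual_antimono[OF assms(1) t'(2)])
  also have "\<dots> \<le> (1 + L + L\<^sup>2) * norm (z s - u (s + 1))"
    unfolding residual_def by (intro residual_le_step z_in u_step z_step assms)
  finally show ?thesis .
qed

end

section \<open>Runs compared with a solution of the variational inequality\<close>

locale extragradient_solution = extragradient_run K F L z u
  for K :: "'a::real_inner set" and F :: "'a \<Rightarrow> 'a" and L :: real and z u :: "nat \<Rightarrow> 'a" +
  fixes s :: 'a
  assumes s_in: "s \<in> K" and s_vi: "\<And>q. q \<in> K \<Longrightarrow> 0 \<le> F s \<bullet> (q - s)"
begin

lemma gap_nonneg: "1 \<le> t \<Longrightarrow> 0 \<le> F (u (t + 1)) \<bullet> (u (t + 1) - s)"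
  using mono[OF u_in s_in, of t] s_vi[OF u_in, of t] by (simp add: inner_diff_left)

lemma dist_z:
  assumes "1 \<le> t" shows "norm (z t - s) \<le> norm (z 1 - s)"
proof -
  obtain T where T: "t = T + 1" using assms by (cases t) auto
  have "0 \<le> (1 - L\<^sup>2) * (\<Sum>t=1..T. (norm (z t - u (t + 1)))\<^sup>2)"
    using L_nonneg L_le_1 by (intro mult_nonneg_nonneg sum_nonneg) (auto simp: power_le_one)
  moreover have "0 \<le> (\<Sum>t=1..T. F (u (t + 1)) \<bullet> (u (t + 1) - s))"
    using gap_nonneg by (intro sum_nonneg) auto
  ultimately have "(norm (z t - s))\<^sup>2 \<le> (norm (z 1 - s))\<^sup>2"
    using energy[OF s_in, of T] unfolding T by linarith
  thus ?thesis by (rule power2_le_imp_le) simp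
qed

lemma dist_u:
  assumes "1 \<le> t"
  shows "(norm (u (t + 1) - s))\<^sup>2 \<le> (1 + L\<^sup>2) * (norm (z 1 - s))\<^sup>2"
proof -
  have "(norm (u (t + 1) - s))\<^sup>2 \<le> (1 + L\<^sup>2) * (norm (z t - s))\<^sup>2"
    by (intro half_step_dist_solution z_in u_step s_in s_vi assms)
  also have "\<dots> \<le> (1 + L\<^sup>2) * (norm (z 1 - s))\<^sup>2"
    by (intro mult_left_mono power_mono dist_z assms) auto
  finally show ?thesis .
qed

text \<open>Up to a constant, step \<open>T\<close> is dominated by every earlier step, so
  \<open>T\<close> times its square is controlled by the sum of squares in
  \<open>energy\<close>.\<close>

lemma step_bound:
  assumes T: "1 \<le> T"
  shows "(1 - L\<^sup>2) * (real T * (norm (z T - u (T + 1)))\<^sup>2) \<le> (1 + L + L\<^sup>2)\<^sup>2 * (norm (z 1 - s))\<^sup>2"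
proof -
  have "real T * (norm (z T - u (T + 1)))\<^sup>2 = (\<Sum>t=1..T. (norm (z T - u (T + 1)))\<^sup>2)" by simp
  also have "\<dots> \<le> (\<Sum>t=1..T. (1 + L + L\<^sup>2)\<^sup>2 * (norm (z t - u (t + 1)))\<^sup>2)"
    unfolding power_mult_distrib[symmetric] by (intro sum_mono power_mono step_le_step) auto
  finally have "(1 - L\<^sup>2) * (real T * (norm (z T - u (T + 1)))\<^sup>2)
      \<le> (1 - L\<^sup>2) * (\<Sum>t=1..T. (1 + L + L\<^sup>2)\<^sup>2 * (norm (z t - u (t + 1)))\<^sup>2)"
    using L_nonneg L_le_1 by (intro mult_left_mono) (auto simp: power_le_one)
  also have "\<dots> = (1 + L + L\<^sup>2)\<^sup>2 * ((1 - L\<^sup>2) * (\<Sum>t=1..T. (norm (z t - u (t + 1)))\<^sup>2))"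
    by (simp add: sum_distrib_left mult_ac)
  also have "\<dots> \<le> (1 + L + L\<^sup>2)\<^sup>2 * (norm (z 1 - s))\<^sup>2"
  proof (rule mult_left_mono)
    have "0 \<le> (\<Sum>t=1..T. F (u (t + 1)) \<bullet> (u (t + 1) - s))"
      using gap_nonneg by (intro sum_nonneg) auto
    thus "(1 - L\<^sup>2) * (\<Sum>t=1..T. (norm (z t - u (t + 1)))\<^sup>2) \<le> (norm (z 1 - s))\<^sup>2"
      using energy[OF s_in, of T] zero_le_power2[of "norm (z (T + 1) - s)"] by linarith
  qed simp
  finally show ?thesis .
qed

text \<open>The constant is \<open>5/4 \<cdot> 9/4\<close>, rounding up \<open>\<surd>(1 + L\<^sup>2)\<close> and \<open>1 + L + L\<^sup>2\<close>.\<close>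

lemma last_iterate:
  assumes T: "1 \<le> T" and L: "L\<^sup>2 = 1 / 2"
  shows "norm (F (u (T + 1)) + (z T - F (z T) - u (T + 1)))
           \<le> 45 / 16 * sqrt 2 * norm (z 1 - s) / sqrt (real T)"
proof -
  have "L \<le> 3 / 4" by (rule power2_le_imp_le) (simp_all add: L power_divide)
  hence q: "(1 + L + L\<^sup>2)\<^sup>2 \<le> (9 / 4)\<^sup>2"
    using L_nonneg by (intro power_mono) (auto simp: L)
  have "real T * (norm (F (u (T + 1)) + (z T - F (z T) - u (T + 1))))\<^sup>2
      \<le> real T * (3 / 2 * (norm (z T - u (T + 1)))\<^sup>2)"
    using half_step_residual[OF z_in u_step, OF T T] by (intro mult_left_mono) (auto simp: L)
  also have "\<dots> \<le> 3 * ((9 / 4)\<^sup>2 * (norm (z 1 - s))\<^sup>2)"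
  proof -
    have "(1 - 1 / 2) * (real T * (norm (z T - u (T + 1)))\<^sup>2) \<le> (1 + L + L\<^sup>2)\<^sup>2 * (norm (z 1 - s))\<^sup>2"
      using step_bound[OF T] L by metis
    also have "\<dots> \<le> (9 / 4)\<^sup>2 * (norm (z 1 - s))\<^sup>2" by (rule mult_right_mono[OF q]) simp
    finally show ?thesis by (simp add: mult_ac)
  qed
  \<comment> \<open>Here \<open>3 / 2 \<le> (5 / 4)\<^sup>2\<close>, and \<open>sqrt 2\<close>
    accounts for the factor \<open>1 / (1 - L\<^sup>2) = 2\<close> from
    \<open>step_bound\<close>.\<close>
  also have "\<dots> \<le> (45 / 16 * sqrt 2 * norm (z 1 - s))\<^sup>2"
    by (simp add: power_mult_distrib power_divide)
  finally have "(sqrt (real T) * norm (F (u (T + 1)) + (z T - F (z T) - u (T + 1))))\<^sup>2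
      \<le> (45 / 16 * sqrt 2 * norm (z 1 - s))\<^sup>2"
    by (simp add: power_mult_distrib)
  hence "sqrt (real T) * norm (F (u (T + 1)) + (z T - F (z T) - u (T + 1)))
      \<le> 45 / 16 * sqrt 2 * norm (z 1 - s)"
    by (rule power2_le_imp_le) simp
  thus ?thesis using T by (simp add: field_simps)
qed

end

subsection \<open>Symmetric matrices and their eigenvalues\<close>

lemma sym_mats_inner:
  fixes M :: "real^'n^'n"
  assumes "M \<in> sym_mats"
  shows "u \<bullet> (M *v w) = (M *v u) \<bullet> w"
proof -
  have "u v* M = M *v u"
    using assms transpose_matrix_vector[of M u] by (simp add: sym_mats_def)
  thus ?thesis using dot_lmul_matrix[of u M w] by simp
qed

lemma outer_mult_vec: "outer v *v u = (v \<bullet> u) *\<^sub>R v"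
  by (simp add: vec_eq_iff outer_def matrix_vector_mult_def inner_vec_def sum_distrib_left mult_ac)

lemma inner_outer: "M \<bullet> outer v = v \<bullet> (M *v v)"
  by (simp add: outer_def matrix_vector_mult_def inner_vec_def sum_distrib_left mult_ac)

lemma outer_in_sym_mats: "outer v \<in> sym_mats"
  by (simp add: sym_mats_def transpose_def outer_def vec_eq_iff)

lemma sum_mult_vec: "(\<Sum>i\<in>I. M i) *v (u::real^'n) = (\<Sum>i\<in>I. M i *v u)"
  by (induction I rule: infinite_finite_induct) (auto simp: matrix_vector_mult_add_rdistrib)

lemma outer_sum_form:
  "u \<bullet> ((\<Sum>i\<in>I. c i *\<^sub>R outer (v i)) *v u) = (\<Sum>i\<in>I. c i * (v i \<bullet> u)\<^sup>2)"
  by (simp add: sum_mult_vec scaleR_matrix_vector_assoc[symmetric] outer_mult_vec inner_sum_right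
      power2_eq_square inner_commute mult_ac)

lemma psd_mats_outer_sum:
  assumes "\<And>i. i \<in> I \<Longrightarrow> 0 \<le> c i"
  shows "(\<Sum>i\<in>I. c i *\<^sub>R outer (v i)) \<in> psd_mats"
  unfolding psd_mats_def using assms
  by (auto simp: outer_sum_form intro!: subspace_sum subspace_scale subspace_sym_mats
      outer_in_sym_mats sum_nonneg)

text \<open>A form that is nonnegative on \<open>S\<close> and vanishes at \<open>u\<close> is
  minimal there, so its derivative in every direction of \<open>S\<close> is zero.\<close>

lemma sym_form_zero:
  fixes M :: "real^'n^'n"
  assumes M: "M \<in> sym_mats" and S: "subspace S" and pos: "\<And>w. w \<in> S \<Longrightarrow> 0 \<le> w \<bullet> (M *v w)"
    and u: "u \<in> S" "u \<bullet> (M *v u) = 0" and w: "w \<in> S"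
  shows "w \<bullet> (M *v u) = 0"
proof -
  \<comment> \<open>Near-optimal step along \<open>w\<close>; the denominator \<open>c + 1\<close>
    instead of \<open>c\<close> cannot vanish, and the form still becomes negative unless
    \<open>a = 0\<close>.\<close>
  define a c t where "a = w \<bullet> (M *v u)" and "c = w \<bullet> (M *v w)" and "t = - a / (c + 1)"
  have c: "0 \<le> c" using pos[OF w] by (simp add: c_def)
  have "u + t *\<^sub>R w \<in> S" using S u w by (intro subspace_add subspace_scale)
  from pos[OF this] have "0 \<le> 2 * t * a + t\<^sup>2 * c"
    using u(2) sym_mats_inner[OF M, of u w]
    by (simp add: a_def c_def matrix_vector_right_distrib matrix_vector_mult_scaleR inner_simps
        inner_commute power2_eq_square algebra_simps)
  also have "\<dots> = - (a\<^sup>2 * (c + 2)) / (c + 1)\<^sup>2"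
  proof -
    have "c + 1 \<noteq> 0" using c by linarith
    thus ?thesis by (simp add: t_def divide_simps) (simp add: power2_eq_square algebra_simps)
  qed
  finally have "0 \<le> - (a\<^sup>2 * (c + 2)) / (c + 1)\<^sup>2" .
  moreover have "0 < (c + 1)\<^sup>2" using c by simp
  ultimately have "a\<^sup>2 * (c + 2) \<le> 0" by (simp add: divide_le_0_iff)
  hence "a = 0" using c by (simp add: mult_le_0_iff)
  thus ?thesis by (simp add: a_def)
qed

lemma psd_mats_kernel:
  assumes "M \<in> psd_mats" "u \<bullet> (M *v u) = 0"
  shows "M *v u = 0"
  using sym_form_zero[of M UNIV u "M *v u"] assms by (auto simp: psd_mats_def)

lemma dim_orthogonal_ge:
  fixes V :: "'a::euclidean_space set"
  assumes "finite V"
  shows "DIM('a) \<le> dim {u. \<forall>x\<in>V. x \<bullet> u = 0} + card V"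
proof -
  have "dim {y \<in> UNIV. \<forall>x \<in> span V. orthogonal x y} + dim (span V) = DIM('a)"
    using dim_subspace_orthogonal_to_vectors[of "span V" UNIV] by simp
  moreover have "{y \<in> UNIV. \<forall>x \<in> span V. orthogonal x y} \<subseteq> {u. \<forall>x\<in>V. x \<bullet> u = 0}"
    by (auto simp: orthogonal_def span_base)
  hence "dim {y \<in> UNIV. \<forall>x \<in> span V. orthogonal x y} \<le> dim {u. \<forall>x\<in>V. x \<bullet> u = 0}"
    by (rule dim_subset)
  moreover have "dim (span V) \<le> card V" using assms dim_le_card[of V V] by (simp add: span_superset)
  ultimately show ?thesis by linarith
qed

lemma subspace_orthogonal: "subspace {u. \<forall>x\<in>V. x \<bullet> u = 0}"
  by (auto simp: subspace_def inner_simps)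

lemma orthonormal_expand:
  fixes v :: "nat \<Rightarrow> 'a::euclidean_space"
  assumes v: "\<forall>i\<in>{1..DIM('a)}. \<forall>j\<in>{1..DIM('a)}. v i \<bullet> v j = (if i = j then 1 else 0)"
  shows "(\<Sum>i=1..DIM('a). (v i \<bullet> u) *\<^sub>R v i) = u"
proof -
  let ?I = "{1..DIM('a)}"
  have inj: "inj_on v ?I"
  proof (rule inj_onI)
    fix i j assume ij: "i \<in> ?I" "j \<in> ?I" "v i = v j"
    have "v i \<bullet> v j = 1" using v ij(1) unfolding ij(3)[symmetric] by simp
    thus "i = j" using v ij(1,2) by (cases "i = j") auto
  qed
  have orth: "pairwise orthogonal (v ` ?I)"
    unfolding pairwise_def orthogonal_def using v by auto
  have nrm: "\<And>x. x \<in> v ` ?I \<Longrightarrow> norm x = 1"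
    using v by (auto simp: norm_eq_1)
  have "independent (v ` ?I)"
    using nrm by (intro pairwise_orthogonal_independent orth) force
  moreover have "card (v ` ?I) = dim (UNIV :: 'a set)" using inj by (simp add: card_image)
  ultimately have "span (v ` ?I) = UNIV"
    using card_ge_dim_independent[of "v ` ?I" UNIV] by auto
  from orthonormal_basis_expand[OF orth nrm, of u] this
  have "(\<Sum>x\<in>v ` ?I. (u \<bullet> x) *\<^sub>R x) = u" by simp
  thus ?thesis using inj by (simp add: sum.reindex inner_commute)
qed

section \<open>The spectral theorem for real symmetric matrices\<close>

text \<open>\<open>u\<close> maximises the Rayleigh quotient on the unit sphere of \<open>S\<close>,
  by compactness. Then \<open>\<mu>\<close> times the identity minus \<open>M\<close> is nonnegative
  on \<open>S\<close> and vanishes at \<open>u\<close>, so \<open>sym_form_zero\<close> applies with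
  the test vector \<open>?N *v u\<close>, which lies in \<open>S\<close> by invariance.\<close>

lemma max_eigenvector_on_subspace:
  fixes M :: "real^'n^'n"
  assumes M: "M \<in> sym_mats" and S: "subspace S" and inv: "\<And>u. u \<in> S \<Longrightarrow> M *v u \<in> S"
    and nz: "dim S \<noteq> 0"
  obtains u \<mu> where "u \<in> S" "norm u = 1" "M *v u = \<mu> *\<^sub>R u"
    "\<And>w. w \<in> S \<Longrightarrow> w \<bullet> (M *v w) \<le> \<mu> * (w \<bullet> w)"
proof -
  have "compact (S \<inter> sphere 0 1)" using closed_subspace[OF S] by (simp add: closed_Int_compact)
  moreover obtain x where x: "x \<in> S" "x \<noteq> 0" using nz by (auto simp: dim_eq_0)
  have "x /\<^sub>R norm x \<in> S \<inter> sphere 0 1" using x S by (auto simp: subspace_scale)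
  hence "S \<inter> sphere 0 1 \<noteq> {}" by blast
  moreover have "continuous_on (S \<inter> sphere 0 1) (\<lambda>u. u \<bullet> (M *v u))"
    by (intro continuous_on_inner continuous_on_id linear_continuous_on matrix_vector_mul_bounded_linear)
  ultimately obtain u where "u \<in> S \<inter> sphere 0 1"
    and "\<forall>w \<in> S \<inter> sphere 0 1. w \<bullet> (M *v w) \<le> u \<bullet> (M *v u)"
    using continuous_attains_sup[of "S \<inter> sphere 0 1" "\<lambda>u. u \<bullet> (M *v u)"] by blast
  hence u: "u \<in> S" "norm u = 1"
    and max: "\<And>w. w \<in> S \<Longrightarrow> norm w = 1 \<Longrightarrow> w \<bullet> (M *v w) \<le> u \<bullet> (M *v u)"
    by auto
  define \<mu> where "\<mu> = u \<bullet> (M *v u)"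
  have bound: "w \<bullet> (M *v w) \<le> \<mu> * (w \<bullet> w)" if w: "w \<in> S" for w
  proof (cases "w = 0")
    case False
    have "(w /\<^sub>R norm w) \<bullet> (M *v (w /\<^sub>R norm w)) \<le> \<mu>"
      unfolding \<mu>_def using w S False by (intro max) (auto simp: subspace_scale)
    hence "(w \<bullet> (M *v w)) / (norm w)\<^sup>2 \<le> \<mu>"
      by (simp add: matrix_vector_mult_scaleR power2_eq_square divide_simps)
    thus ?thesis using False by (simp add: divide_simps power2_norm_eq_inner)
  qed simp
  let ?N = "\<mu> *\<^sub>R mat 1 - M"
  have N: "?N *v w = \<mu> *\<^sub>R w - M *v w" for w
    by (simp add: matrix_vector_mult_diff_rdistrib scaleR_matrix_vector_assoc[symmetric])
  have "mat 1 \<in> (sym_mats :: (real^'n^'n) set)" by (simp add: sym_mats_def)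
  hence Nsym: "?N \<in> sym_mats" using M by (intro subspace_diff subspace_scale subspace_sym_mats)
  have NS: "?N *v u \<in> S" unfolding N using u inv S by (intro subspace_diff subspace_scale) auto
  have "(?N *v u) \<bullet> (?N *v u) = 0"
  proof (rule sym_form_zero[OF Nsym S _ u(1) _ NS])
    show "0 \<le> w \<bullet> (?N *v w)" if "w \<in> S" for w
      using bound[OF that] unfolding N by (simp add: inner_diff_right)
    show "u \<bullet> (?N *v u) = 0"
      using u(2) unfolding N by (simp add: inner_diff_right \<mu>_def norm_eq_1)
  qed
  hence "M *v u = \<mu> *\<^sub>R u" by (simp add: N)
  with u bound show thesis using that by blast
qed

text \<open>Eigenvectors are chosen one at a time, each maximising the form on the orthogonal
  complement of the previous ones, which is invariant under a symmetric matrix.\<close>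

theorem spectral_theorem:
  fixes M :: "real^'n^'n"
  assumes M: "M \<in> sym_mats"
  obtains lam v where "eigen_decomp M lam v"
proof -
  \<comment> \<open>The last conjunct bounds the form on the complement still to be treated; it is
    what keeps the next eigenvalue below the earlier ones.\<close>
  define P where "P k lam v \<longleftrightarrow>
     (\<forall>i\<in>{1..k}. \<forall>j\<in>{1..k}. v i \<bullet> v j = (if i = j then 1 else 0)) \<and>
     (\<forall>i\<in>{1..k}. \<forall>j\<in>{1..k}. i \<le> j \<longrightarrow> lam j \<le> lam i) \<and>
     (\<forall>i\<in>{1..k}. M *v v i = lam i *\<^sub>R v i) \<and>
     (\<forall>i\<in>{1..k}. \<forall>u. (\<forall>j\<in>{1..k}. v j \<bullet> u = 0) \<longrightarrow> u \<bullet> (M *v u) \<le> lam i * (u \<bullet> u))"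
    for k :: nat and lam :: "nat \<Rightarrow> real" and v :: "nat \<Rightarrow> real^'n"
  have "k \<le> CARD('n) \<Longrightarrow> \<exists>lam v. P k lam v" for k
  proof (induction k)
    case 0
    show ?case by (simp add: P_def)
  next
    case (Suc k)
    then obtain lam v where P: "P k lam v" by auto
    have orth: "v i \<bullet> v j = (if i = j then 1 else 0)" if "i \<in> {1..k}" "j \<in> {1..k}" for i j
      using P that unfolding P_def by blast
    have anti: "lam j \<le> lam i" if "i \<in> {1..k}" "j \<in> {1..k}" "i \<le> j" for i j
      using P that unfolding P_def by blast
    have eig: "M *v v i = lam i *\<^sub>R v i" if "i \<in> {1..k}" for i
      using P that unfolding P_def by blast
    have bnd: "u \<bullet> (M *v u) \<le> lam i * (u \<bullet> u)" if "i \<in> {1..k}" "\<And>j. j \<in> {1..k} \<Longrightarrow> v j \<bullet> u = 0" for i u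
      using P that unfolding P_def by blast
    let ?S = "{u. \<forall>x\<in>v ` {1..k}. x \<bullet> u = 0}"
    have "CARD('n) \<le> dim ?S + card (v ` {1..k})"
      using dim_orthogonal_ge[of "v ` {1..k}"] by simp
    moreover have "card (v ` {1..k}) \<le> k" using card_image_le[of "{1..k}" v] by simp
    ultimately have nz: "dim ?S \<noteq> 0" using Suc.prems by linarith
    have inv: "M *v u \<in> ?S" if "u \<in> ?S" for u
      using that by (auto simp: sym_mats_inner[OF M] eig)
    obtain u \<mu> where u: "u \<in> ?S" "norm u = 1" "M *v u = \<mu> *\<^sub>R u"
      and max: "\<And>w. w \<in> ?S \<Longrightarrow> w \<bullet> (M *v w) \<le> \<mu> * (w \<bullet> w)"
      by (rule max_eigenvector_on_subspace[OF M subspace_orthogonal], erule inv, rule nz, rule that)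
    have uu: "u \<bullet> u = 1" using u(2) by (simp add: norm_eq_1)
    have uv: "u \<bullet> v i = 0" "v i \<bullet> u = 0" if "i \<in> {1..k}" for i
      using u(1) that by (auto simp: inner_commute)
    have \<mu>: "\<mu> \<le> lam i" if "i \<in> {1..k}" for i
      using bnd[OF that uv(2)] u(3) uu by simp
    define v' lam' where "v' = v(Suc k := u)" and "lam' = lam(Suc k := \<mu>)"
    have old: "v' i = v i" "lam' i = lam i" if "i \<in> {1..k}" for i
      using that by (auto simp: v'_def lam'_def)
    have new: "v' (Suc k) = u" "lam' (Suc k) = \<mu>" by (auto simp: v'_def lam'_def)
    have I: "{1..Suc k} = insert (Suc k) {1..k}" by auto
    have "\<forall>i\<in>{1..Suc k}. \<forall>j\<in>{1..Suc k}. v' i \<bullet> v' j = (if i = j then 1 else 0)"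
      unfolding I
    proof (intro ballI)
      fix i j assume "i \<in> insert (Suc k) {1..k}" "j \<in> insert (Suc k) {1..k}"
      then consider "i = Suc k" "j = Suc k" | "i = Suc k" "j \<in> {1..k}" | "i \<in> {1..k}" "j = Suc k"
        | "i \<in> {1..k}" "j \<in> {1..k}" by blast
      thus "v' i \<bullet> v' j = (if i = j then 1 else 0)"
        by cases (use orth uv uu in \<open>simp_all add: old new del: atLeastAtMost_iff, auto\<close>)
    qed
    moreover have "\<forall>i\<in>{1..Suc k}. \<forall>j\<in>{1..Suc k}. i \<le> j \<longrightarrow> lam' j \<le> lam' i"
      unfolding I
    proof (intro ballI impI)
      fix i j assume "i \<in> insert (Suc k) {1..k}" "j \<in> insert (Suc k) {1..k}" "i \<le> j"
      then consider "i = Suc k" "j = Suc k" | "i \<in> {1..k}" "j = Suc k"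
        | "i \<in> {1..k}" "j \<in> {1..k}" by force
      thus "lam' j \<le> lam' i"
        by cases (use anti \<mu> \<open>i \<le> j\<close> in \<open>simp_all add: old new del: atLeastAtMost_iff\<close>)
    qed
    moreover have "\<forall>i\<in>{1..Suc k}. M *v v' i = lam' i *\<^sub>R v' i"
      unfolding I using eig u by (auto simp: old new simp del: atLeastAtMost_iff)
    moreover have "\<forall>i\<in>{1..Suc k}. \<forall>w. (\<forall>j\<in>{1..Suc k}. v' j \<bullet> w = 0) \<longrightarrow> w \<bullet> (M *v w) \<le> lam' i * (w \<bullet> w)"
      unfolding I using bnd max by (auto simp: old new simp del: atLeastAtMost_iff)
    ultimately have "P (Suc k) lam' v'" unfolding P_def by blast
    thus ?case by blast
  qed
  from this[OF order_refl] obtain lam v where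
    orth: "\<forall>i\<in>{1..CARD('n)}. \<forall>j\<in>{1..CARD('n)}. v i \<bullet> v j = (if i = j then 1 else 0)"
    and anti: "\<forall>i\<in>{1..CARD('n)}. \<forall>j\<in>{1..CARD('n)}. i \<le> j \<longrightarrow> lam j \<le> lam i"
    and eig: "\<forall>i\<in>{1..CARD('n)}. M *v v i = lam i *\<^sub>R v i" unfolding P_def by blast
  have "M *v u = (\<Sum>i=1..CARD('n). lam i *\<^sub>R outer (v i)) *v u" for u
  proof -
    have "(\<Sum>i=1..CARD('n). (v i \<bullet> u) *\<^sub>R v i) = u" using orthonormal_expand[of v u] orth by simp
    hence "M *v u = M *v (\<Sum>i=1..CARD('n). (v i \<bullet> u) *\<^sub>R v i)" by simp
    also have "\<dots> = (\<Sum>i=1..CARD('n). (v i \<bullet> u) *\<^sub>R (M *v v i))"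
      by (simp add: linear_sum[OF matrix_vector_mul_linear] matrix_vector_mult_scaleR)
    also have "\<dots> = (\<Sum>i=1..CARD('n). (lam i *\<^sub>R outer (v i)) *v u)"
      using eig by (intro sum.cong) (auto simp: scaleR_matrix_vector_assoc[symmetric] outer_mult_vec)
    finally show ?thesis by (simp add: sum_mult_vec)
  qed
  hence "M = (\<Sum>i=1..CARD('n). lam i *\<^sub>R outer (v i))" by (metis matrix_eq)
  with orth anti show thesis using that unfolding eigen_decomp_def by blast
qed

section \<open>Eigenvalues through quadratic forms\<close>

lemma eigen_decomp_orthonormal:
  fixes M :: "real^'n^'n"
  assumes "eigen_decomp M lam v" "i \<in> {1..CARD('n)}" "j \<in> {1..CARD('n)}"
  shows "v i \<bullet> v j = (if i = j then 1 else 0)"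
  using assms unfolding eigen_decomp_def by blast

lemma eigen_decomp_antimono:
  fixes M :: "real^'n^'n"
  assumes "eigen_decomp M lam v" "i \<in> {1..CARD('n)}" "j \<in> {1..CARD('n)}" "i \<le> j"
  shows "lam j \<le> lam i"
  using assms unfolding eigen_decomp_def by blast

lemma eigen_decomp_eq:
  fixes M :: "real^'n^'n"
  assumes "eigen_decomp M lam v"
  shows "M = (\<Sum>i=1..CARD('n). lam i *\<^sub>R outer (v i))"
  using assms unfolding eigen_decomp_def by blast

lemma eigen_decomp_expand:
  fixes M :: "real^'n^'n"
  assumes "eigen_decomp M lam v"
  shows "(\<Sum>i=1..CARD('n). (v i \<bullet> u) *\<^sub>R v i) = u"
proof -
  have "\<forall>i\<in>{1..DIM(real^'n)}. \<forall>j\<in>{1..DIM(real^'n)}. v i \<bullet> v j = (if i = j then 1 else 0)"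
    using assms by (simp add: eigen_decomp_def)
  from orthonormal_expand[OF this, of u] show ?thesis by simp
qed

lemma inner_outer_sum:
  "Q \<bullet> (\<Sum>i\<in>I. c i *\<^sub>R outer (v i)) = (\<Sum>i\<in>I. c i * (v i \<bullet> (Q *v v i)))"
  by (simp add: inner_sum_right inner_outer)

lemma eigen_decomp_form:
  fixes M :: "real^'n^'n"
  assumes "eigen_decomp M lam v"
  shows "u \<bullet> (M *v u) = (\<Sum>i=1..CARD('n). lam i * (v i \<bullet> u)\<^sup>2)"
  by (subst eigen_decomp_eq[OF assms]) (rule outer_sum_form)

lemma eigen_decomp_norm:
  fixes M :: "real^'n^'n"
  assumes "eigen_decomp M lam v"
  shows "u \<bullet> u = (\<Sum>i=1..CARD('n). (v i \<bullet> u)\<^sup>2)"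
proof -
  have "u \<bullet> u = u \<bullet> (\<Sum>i=1..CARD('n). (v i \<bullet> u) *\<^sub>R v i)"
    by (simp only: eigen_decomp_expand[OF assms])
  thus ?thesis by (simp add: inner_sum_right inner_commute power2_eq_square)
qed

text \<open>The hypothesis says that \<open>u\<close> lies in the span of the first \<open>k\<close>
  eigenvectors. Together with \<open>eigen_decomp_form_le\<close> this is the form of the min-max
  principle used for dimension counts.\<close>

lemma eigen_decomp_form_ge:
  fixes M :: "real^'n^'n"
  assumes M: "eigen_decomp M lam v" and k: "k \<in> {1..CARD('n)}"
    and u: "\<And>i. i \<in> {k<..CARD('n)} \<Longrightarrow> v i \<bullet> u = 0"
  shows "lam k * (u \<bullet> u) \<le> u \<bullet> (M *v u)"
  unfolding eigen_decomp_norm[OF M, of u] eigen_decomp_form[OF M] sum_distrib_left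
proof (rule sum_mono)
  fix i assume i: "i \<in> {1..CARD('n)}"
  show "lam k * (v i \<bullet> u)\<^sup>2 \<le> lam i * (v i \<bullet> u)\<^sup>2"
  proof (cases "i \<le> k")
    case True
    thus ?thesis by (intro mult_right_mono eigen_decomp_antimono[OF M i k]) auto
  qed (use u i in simp)
qed

lemma eigen_decomp_form_le:
  fixes M :: "real^'n^'n"
  assumes M: "eigen_decomp M lam v" and k: "k \<in> {1..CARD('n)}"
    and u: "\<And>i. i \<in> {1..<k} \<Longrightarrow> v i \<bullet> u = 0"
  shows "u \<bullet> (M *v u) \<le> lam k * (u \<bullet> u)"
  unfolding eigen_decomp_norm[OF M, of u] eigen_decomp_form[OF M] sum_distrib_left
proof (rule sum_mono)
  fix i assume i: "i \<in> {1..CARD('n)}"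
  show "lam i * (v i \<bullet> u)\<^sup>2 \<le> lam k * (v i \<bullet> u)\<^sup>2"
  proof (cases "k \<le> i")
    case True
    thus ?thesis by (intro mult_right_mono eigen_decomp_antimono[OF M k i]) auto
  qed (use u i in simp)
qed

lemma eigen_decomp_form_eigenvector:
  fixes M :: "real^'n^'n"
  assumes M: "eigen_decomp M lam v" and i: "i \<in> {1..CARD('n)}"
  shows "v i \<bullet> (M *v v i) = lam i"
proof -
  have "v i \<bullet> (M *v v i) = (\<Sum>j=1..CARD('n). if j = i then lam i else 0)"
    unfolding eigen_decomp_form[OF M]
    by (intro sum.cong) (auto simp: eigen_decomp_orthonormal[OF M _ i])
  thus ?thesis using i by simp
qed

text \<open>Membership in the span of the first \<open>k\<close> vectors \<open>v\<close> and
  orthogonality to the first \<open>k - 1\<close> vectors \<open>v'\<close> amount to at most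
  \<open>n - 1\<close> linear conditions, so a nonzero \<open>u\<close> meets them all; the two form
  bounds at \<open>u\<close> compare the eigenvalues.\<close>

lemma eigen_decomp_le_unique:
  fixes M :: "real^'n^'n"
  assumes M: "eigen_decomp M lam v" "eigen_decomp M lam' v'" and k: "k \<in> {1..CARD('n)}"
  shows "lam k \<le> lam' k"
proof -
  let ?V = "v ` {k<..CARD('n)} \<union> v' ` {1..<k}"
  define S where "S = {u. \<forall>x\<in>?V. x \<bullet> u = 0}"
  have "card ?V \<le> card (v ` {k<..CARD('n)}) + card (v' ` {1..<k})" by (rule card_Un_le)
  also have "\<dots> \<le> (CARD('n) - k) + (k - 1)"
    using card_image_le[of "{k<..CARD('n)}" v] card_image_le[of "{1..<k}" v'] by simp
  also have "\<dots> < CARD('n)" using k by auto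
  finally have "card ?V < CARD('n)" .
  moreover have "CARD('n) \<le> dim S + card ?V" using dim_orthogonal_ge[of ?V] by (simp add: S_def)
  ultimately have "dim S \<noteq> 0" by linarith
  then obtain u where u: "u \<in> S" "u \<noteq> 0" by (auto simp: dim_eq_0)
  have "lam k * (u \<bullet> u) \<le> u \<bullet> (M *v u)"
    using u by (intro eigen_decomp_form_ge[OF M(1) k]) (auto simp: S_def)
  also have "\<dots> \<le> lam' k * (u \<bullet> u)"
    using u by (intro eigen_decomp_form_le[OF M(2) k]) (auto simp: S_def)
  finally show ?thesis using u by simp
qed

text \<open>Applying \<open>eigen_decomp_le_unique\<close> in both directions shows that the
  description in \<open>eigval\<close> has exactly one solution.\<close>

lemma eigval_eq:
  fixes M :: "real^'n^'n"
  assumes M: "eigen_decomp M lam v" and k: "k \<in> {1..CARD('n)}"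
  shows "eigval M k = lam k"
  unfolding eigval_def
proof (rule the_equality)
  fix \<mu> assume "\<exists>lam v. eigen_decomp M lam v \<and> \<mu> = lam k"
  thus "\<mu> = lam k" using eigen_decomp_le_unique[OF M _ k] eigen_decomp_le_unique[OF _ M k] by force
qed (use M in blast)

lemma eigen_decomp_rank_le:
  fixes M :: "real^'n^'n"
  assumes M: "eigen_decomp M lam v" and k: "1 \<le> k" "k \<le> CARD('n)"
    and zero: "\<And>i. i \<in> {k..CARD('n)} \<Longrightarrow> lam i = 0"
  shows "rank M < k"
proof -
  have "range (\<lambda>x. M *v x) \<subseteq> span (v ` {1..<k})"
  proof clarify
    fix x
    have "M *v x = (\<Sum>i=1..CARD('n). (lam i * (v i \<bullet> x)) *\<^sub>R v i)"
      by (subst eigen_decomp_eq[OF M])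
        (simp add: sum_mult_vec scaleR_matrix_vector_assoc[symmetric] outer_mult_vec)
    moreover have "(lam i * (v i \<bullet> x)) *\<^sub>R v i \<in> span (v ` {1..<k})" if "i \<in> {1..CARD('n)}" for i
    proof (cases "i < k")
      case True
      thus ?thesis using that by (intro span_scale span_base) auto
    qed (use that zero[of i] in \<open>simp add: span_zero\<close>)
    hence "(\<Sum>i=1..CARD('n). (lam i * (v i \<bullet> x)) *\<^sub>R v i) \<in> span (v ` {1..<k})" by (rule span_sum)
    ultimately show "M *v x \<in> span (v ` {1..<k})" by simp
  qed
  hence "rank M \<le> card (v ` {1..<k})"
    unfolding rank_dim_range by (rule dim_le_card) simp
  also have "\<dots> \<le> k - 1" using card_image_le[of "{1..<k}" v] by simp
  finally show ?thesis using k by simp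
qed

text \<open>Otherwise all eigenvalues from index \<open>k\<close> on would be zero, and the range
  would be spanned by \<open>k - 1\<close> vectors.\<close>

lemma eigval_psd_pos:
  fixes M :: "real^'n^'n"
  assumes M: "eigen_decomp M lam v" and psd: "M \<in> psd_mats" and k: "1 \<le> k" "k \<le> rank M"
  shows "0 < lam k"
proof (rule ccontr)
  assume neg: "\<not> 0 < lam k"
  have kn: "k \<le> CARD('n)" using k rank_bound[of M] by simp
  have "lam i = 0" if i: "i \<in> {k..CARD('n)}" for i
  proof -
    have "lam i \<le> lam k" using i k kn by (intro eigen_decomp_antimono[OF M]) auto
    moreover have "0 \<le> lam i"
      using eigen_decomp_form_eigenvector[OF M, of i] psd i k unfolding psd_mats_def
      by (metis (mono_tags, lifting) atLeastAtMost_iff le_trans mem_Collect_eq)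
    ultimately show ?thesis using neg by simp
  qed
  from eigen_decomp_rank_le[OF M k(1) kn this] k(2) show False by simp
qed

text \<open>The relation \<open>k + (r + 1) = n + s\<close> makes the span of the top
  \<open>r + 1\<close> eigenvectors of the perturbed matrix and the span of the top \<open>k\<close>
  eigenvectors of \<open>G\<close> meet in dimension at least \<open>s\<close>. There
  \<open>E\<close> alone must outweigh \<open>\<eta> * \<mu> k\<close>.\<close>

lemma eigval_perturbed_nonpos:
  fixes P G E :: "real^'n^'n"
  assumes P: "P \<in> psd_mats" and G: "G \<in> psd_mats" and compl: "P \<bullet> G = 0" and \<eta>: "0 < \<eta>"
    and g: "eigen_decomp G \<mu> g" and v: "eigen_decomp (P - \<eta> *\<^sub>R G + E) lam v"
    and s: "1 \<le> s" and r: "r < CARD('n)" and k: "k = CARD('n) - r + s - 1" "k \<le> CARD('n)" "0 < \<mu> k"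
    and E: "norm E \<le> \<eta> * (sqrt (real s) * \<mu> k)"
  shows "lam (r + 1) \<le> 0"
proof (rule ccontr)
  assume "\<not> lam (r + 1) \<le> 0"
  hence pos: "0 < lam (r + 1)" by simp
  have k1: "k \<in> {1..CARD('n)}" using k r s by auto
  let ?V = "v ` {r + 1<..CARD('n)} \<union> g ` {k<..CARD('n)}"
  let ?S = "{u. \<forall>x\<in>?V. x \<bullet> u = 0}"
  have "card ?V \<le> card (v ` {r + 1<..CARD('n)}) + card (g ` {k<..CARD('n)})" by (rule card_Un_le)
  also have "\<dots> \<le> (CARD('n) - (r + 1)) + (CARD('n) - k)"
    using card_image_le[of "{r + 1<..CARD('n)}" v] card_image_le[of "{k<..CARD('n)}" g] by simp
  finally have dim: "s \<le> dim ?S" using dim_orthogonal_ge[of ?V] r s k by simp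
  obtain B where B: "B \<subseteq> ?S" "pairwise orthogonal B" "\<And>x. x \<in> B \<Longrightarrow> norm x = 1" "card B = dim ?S"
    by (rule orthonormal_basis_subspace[OF subspace_orthogonal, of ?V]) (rule that)
  obtain C where C: "C \<subseteq> B" "card C = s" "finite C"
    using obtain_subset_with_card_n[of s B] dim B(4) by metis
  have nonneg: "0 \<le> u \<bullet> (Q *v u)" if "Q \<in> psd_mats" for Q :: "real^'n^'n" and u
    using that by (simp add: psd_mats_def)
  have \<mu>: "0 \<le> \<mu> i" if "i \<in> {1..CARD('n)}" for i
    using eigen_decomp_form_eigenvector[OF g that] nonneg[OF G] by metis
  \<comment> \<open>Complementarity as a vanishing sum of nonnegative terms: \<open>P\<close>
    annihilates every eigenvector of \<open>G\<close> with positive eigenvalue, in particular the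
    first \<open>k\<close>.\<close>
  have "(\<Sum>i=1..CARD('n). \<mu> i * (g i \<bullet> (P *v g i))) = 0"
    using compl unfolding eigen_decomp_eq[OF g] inner_outer_sum .
  hence "\<forall>i\<in>{1..CARD('n)}. \<mu> i * (g i \<bullet> (P *v g i)) = 0"
    using \<mu> nonneg[OF P] by (subst (asm) sum_nonneg_eq_0_iff) auto
  moreover have "\<mu> i \<noteq> 0" if "i \<in> {1..k}" for i
    using eigen_decomp_antimono[OF g, of i k] that k by auto
  ultimately have Pg: "P *v g i = 0" if "i \<in> {1..k}" for i
    using psd_mats_kernel[OF P, of "g i"] that k(2) by fastforce
  have lower: "\<eta> * \<mu> k < e \<bullet> (E *v e)" if e: "e \<in> C" for e
  proof -
    have eS: "v i \<bullet> e = 0" if "i \<in> {r + 1<..CARD('n)}" for i using e C B(1) that by auto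
    have eS': "g i \<bullet> e = 0" if "i \<in> {k<..CARD('n)}" for i using e C B(1) that by auto
    have ee: "e \<bullet> e = 1" using e C B(3) by (auto simp: norm_eq_1)
    have "P *v e = P *v (\<Sum>i=1..CARD('n). (g i \<bullet> e) *\<^sub>R g i)"
      by (simp only: eigen_decomp_expand[OF g])
    also have "\<dots> = (\<Sum>i=1..CARD('n). (g i \<bullet> e) *\<^sub>R (P *v g i))"
      by (simp add: linear_sum[OF matrix_vector_mul_linear] matrix_vector_mult_scaleR)
    also have "\<dots> = 0"
    proof (rule sum.neutral, rule ballI)
      fix i assume "i \<in> {1..CARD('n)}"
      thus "(g i \<bullet> e) *\<^sub>R (P *v g i) = 0" using Pg[of i] eS'[of i] by (cases "i \<le> k") auto
    qed
    finally have Pe: "P *v e = 0" .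
    have "lam (r + 1) * (e \<bullet> e) \<le> e \<bullet> ((P - \<eta> *\<^sub>R G + E) *v e)"
      using r eS by (intro eigen_decomp_form_ge[OF v]) auto
    hence "0 < e \<bullet> ((P - \<eta> *\<^sub>R G + E) *v e)" using pos ee by simp
    also have "\<dots> = e \<bullet> (E *v e) - \<eta> * (e \<bullet> (G *v e))"
      by (simp add: matrix_vector_mult_add_rdistrib matrix_vector_mult_diff_rdistrib Pe
          scaleR_matrix_vector_assoc[symmetric] inner_simps)
    finally have "\<eta> * (e \<bullet> (G *v e)) < e \<bullet> (E *v e)" by simp
    moreover have "\<mu> k * (e \<bullet> e) \<le> e \<bullet> (G *v e)"
      using eS' by (intro eigen_decomp_form_ge[OF g k1]) auto
    hence "\<eta> * \<mu> k \<le> \<eta> * (e \<bullet> (G *v e))" using \<eta> ee by simp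
    ultimately show ?thesis by simp
  qed
  \<comment> \<open>The orthogonal projector onto an \<open>s\<close>-dimensional space, of
    Frobenius norm \<open>sqrt s\<close>. Pairing \<open>E\<close> with it sums \<open>s\<close>
    form values at once, which is where the gain of \<open>sqrt s\<close> comes from.\<close>
  define Q where "Q = (\<Sum>e\<in>C. outer e)"
  have "Q \<bullet> Q = (\<Sum>e\<in>C. e \<bullet> (Q *v e))" unfolding Q_def inner_sum_right inner_outer ..
  also have "\<dots> = (\<Sum>e\<in>C. 1)"
  proof (rule sum.cong)
    fix e assume e: "e \<in> C"
    have "e \<bullet> (Q *v e) = (\<Sum>d\<in>C. if d = e then 1 else 0)"
      unfolding Q_def sum_mult_vec inner_sum_right
    proof (rule sum.cong)
      fix d assume d: "d \<in> C"
      have "d \<bullet> e = 0" if "d \<noteq> e"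
        using B(2) d e C that by (auto simp: pairwise_def orthogonal_def)
      moreover have "e \<bullet> e = 1" using B(3) e C by (auto simp: norm_eq_1)
      ultimately show "e \<bullet> (outer d *v e) = (if d = e then 1 else 0)"
        by (auto simp: outer_mult_vec inner_commute)
    qed simp
    thus "e \<bullet> (Q *v e) = 1" using C(3) e by simp
  qed simp
  finally have "norm Q = sqrt (real s)" using C(2) by (simp add: norm_eq_sqrt_inner)
  hence "E \<bullet> Q \<le> norm E * sqrt (real s)" using norm_cauchy_schwarz[of E Q] by simp
  also have "\<dots> \<le> \<eta> * (sqrt (real s) * \<mu> k) * sqrt (real s)" by (intro mult_right_mono E) simp
  also have "\<dots> = real s * (\<eta> * \<mu> k)" by simp
  also have "\<dots> = (\<Sum>e\<in>C. \<eta> * \<mu> k)" by (simp add: C(2))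
  also have "\<dots> < (\<Sum>e\<in>C. e \<bullet> (E *v e))"
    using lower C s by (intro sum_strict_mono) auto
  also have "\<dots> = E \<bullet> Q" by (simp add: Q_def inner_sum_right inner_outer)
  finally show False by simp
qed

section \<open>The positive semidefinite cone and its two projections\<close>

lemma convex_psd_mats: "convex (psd_mats :: (real^'n^'n) set)"
proof (rule convexI)
  fix X Y :: "real^'n^'n" and a b :: real
  assume "X \<in> psd_mats" "Y \<in> psd_mats" "0 \<le> a" "0 \<le> b"
  thus "a *\<^sub>R X + b *\<^sub>R Y \<in> psd_mats"
    by (auto simp: psd_mats_def subspace_sym_mats matrix_vector_mult_add_rdistrib
        scaleR_matrix_vector_assoc[symmetric] inner_simps intro!: subspace_add subspace_scale)
qed

lemma closed_psd_mats: "closed (psd_mats :: (real^'n^'n) set)"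
proof -
  have "psd_mats = sym_mats \<inter> (\<Inter>u. {X :: real^'n^'n. 0 \<le> X \<bullet> outer u})"
    by (auto simp: psd_mats_def inner_outer)
  also have "closed \<dots>"
    by (intro closed_Int closed_INT ballI closed_Collect_le continuous_intros
        closed_subspace subspace_sym_mats)
  finally show ?thesis .
qed

lemma zero_in_psd_mats: "0 \<in> psd_mats"
  by (auto simp: psd_mats_def subspace_0 subspace_sym_mats)

lemma is_proj_closest_point:
  fixes K :: "'a::euclidean_space set"
  assumes K: "convex K" "closed K" "K \<noteq> {}"
  shows "is_proj K x p \<longleftrightarrow> p = closest_point K x"
proof
  have c: "is_proj K x (closest_point K x)"
    using closest_point_in_set[OF K(2,3)] closest_point_dot[OF K(1,2)] by (auto simp: is_proj_def)
  show "is_proj K x p" if "p = closest_point K x" using c that by simp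
  show "p = closest_point K x" if "is_proj K x p"
    using is_proj_nonexpansive[OF that c] by simp
qed

lemma psd_proj_iff: "psd_proj M Y \<longleftrightarrow> is_proj psd_mats M Y"
  using is_proj_closest_point[OF convex_psd_mats closed_psd_mats] zero_in_psd_mats
  unfolding psd_proj_def by blast

text \<open>\<open>M - Y\<close> is the negative part of \<open>M\<close> in the same eigenbasis: it
  is orthogonal to \<open>Y\<close> and pairs nonpositively with every positive semidefinite
  matrix.\<close>

lemma is_proj_psd_spectral:
  fixes M :: "real^'n^'n"
  assumes M: "eigen_decomp M lam v"
  shows "is_proj psd_mats M (\<Sum>i=1..CARD('n). max (lam i) 0 *\<^sub>R outer (v i))" (is "is_proj _ _ ?Y")
proof -
  have diff: "M - ?Y = (\<Sum>i=1..CARD('n). min (lam i) 0 *\<^sub>R outer (v i))"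
    by (subst eigen_decomp_eq[OF M])
      (auto simp: sum_subtractf[symmetric] scaleR_diff_left[symmetric] max_def min_def intro!: sum.cong)
  have vY: "v i \<bullet> (?Y *v v i) = max (lam i) 0" if i: "i \<in> {1..CARD('n)}" for i
  proof -
    have "v i \<bullet> (?Y *v v i) = (\<Sum>j=1..CARD('n). if j = i then max (lam i) 0 else 0)"
      unfolding outer_sum_form
      by (intro sum.cong) (auto simp: eigen_decomp_orthonormal[OF M _ i])
    thus ?thesis using i by simp
  qed
  have "(M - ?Y) \<bullet> (Q - ?Y) \<le> 0" if Q: "Q \<in> psd_mats" for Q
  proof -
    have "(M - ?Y) \<bullet> (Q - ?Y) = (\<Sum>i=1..CARD('n). min (lam i) 0 * (v i \<bullet> ((Q - ?Y) *v v i)))"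
      unfolding diff by (subst inner_commute) (rule inner_outer_sum)
    also have "\<dots> \<le> 0"
    proof (rule sum_nonpos)
      fix i assume i: "i \<in> {1..CARD('n)}"
      have "0 \<le> v i \<bullet> (Q *v v i)" using Q by (simp add: psd_mats_def)
      hence "min (lam i) 0 * (v i \<bullet> (Q *v v i)) \<le> 0" by (intro mult_nonpos_nonneg) auto
      moreover have "min (lam i) 0 * max (lam i) 0 = 0" by (simp add: min_def max_def)
      ultimately show "min (lam i) 0 * (v i \<bullet> ((Q - ?Y) *v v i)) \<le> 0"
        unfolding matrix_vector_mult_diff_rdistrib inner_diff_right vY[OF i] right_diff_distrib by simp
    qed
    finally show ?thesis .
  qed
  thus ?thesis by (auto simp: is_proj_def intro!: psd_mats_outer_sum)
qed

text \<open>Once eigenvalue \<open>r + 1\<close> is nonpositive, the terms beyond \<open>r\<close>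
  vanish and truncation drops nothing. The hypothesis covers all decompositions because the
  truncated projection may pick any of them.\<close>

lemma trunc_psd_proj_iff:
  fixes M :: "real^'n^'n"
  assumes M: "M \<in> sym_mats" and r: "r < CARD('n)"
    and nonpos: "\<And>lam v. eigen_decomp M lam v \<Longrightarrow> lam (r + 1) \<le> 0"
  shows "trunc_psd_proj r M Y \<longleftrightarrow> psd_proj M Y"
proof -
  have eq: "(\<Sum>i=1..r. max (lam i) 0 *\<^sub>R outer (v i)) = (\<Sum>i=1..CARD('n). max (lam i) 0 *\<^sub>R outer (v i))"
    if d: "eigen_decomp M lam v" for lam v
  proof (rule sum.mono_neutral_left)
    show "\<forall>i\<in>{1..CARD('n)} - {1..r}. max (lam i) 0 *\<^sub>R outer (v i) = 0"
    proof
      fix i assume "i \<in> {1..CARD('n)} - {1..r}"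
      hence "lam i \<le> lam (r + 1)" using r by (intro eigen_decomp_antimono[OF d]) auto
      thus "max (lam i) 0 *\<^sub>R outer (v i) = 0" using nonpos[OF d] by simp
    qed
  qed (use r in auto)
  have unique: "p = q" if "is_proj psd_mats M p" "is_proj psd_mats M q" for p q
    using is_proj_nonexpansive[OF that] by simp
  show ?thesis
  proof
    assume "trunc_psd_proj r M Y"
    then obtain lam v where d: "eigen_decomp M lam v"
      and Y: "Y = (\<Sum>i=1..r. max (lam i) 0 *\<^sub>R outer (v i))"
      unfolding trunc_psd_proj_def by blast
    show "psd_proj M Y"
      unfolding psd_proj_iff Y eq[OF d] by (rule is_proj_psd_spectral[OF d])
  next
    assume Y: "psd_proj M Y"
    obtain lam v where d: "eigen_decomp M lam v" by (rule spectral_theorem[OF M])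
    have "Y = (\<Sum>i=1..r. max (lam i) 0 *\<^sub>R outer (v i))"
      using unique[OF Y[unfolded psd_proj_iff] is_proj_psd_spectral[OF d]] eq[OF d] by simp
    thus "trunc_psd_proj r M Y" unfolding trunc_psd_proj_def using d by blast
  qed
qed

subsection \<open>The extragradient method for semidefinite programs\<close>

lemma linear_lin_map: "linear (lin_map A)"
  by (rule linearI) (simp_all add: lin_map_def vec_eq_iff inner_simps)

lemma lin_map_adj_diff: "lin_map_adj A (y - y') = lin_map_adj A y - lin_map_adj A y'"
  by (simp add: lin_map_adj_def scaleR_diff_left sum_subtractf)

lemma lin_map_adj_sym:
  assumes "\<And>i. A i \<in> sym_mats"
  shows "lin_map_adj A y \<in> sym_mats"
  unfolding lin_map_adj_def by (intro subspace_sum subspace_scale subspace_sym_mats assms)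

lemma lin_map_bdd_above: "bdd_above ((\<lambda>X. norm (lin_map A X)) ` {X \<in> sym_mats. norm X \<le> 1})"
proof -
  obtain B where B: "0 < B" "\<And>X. norm (lin_map A X) \<le> B * norm X"
    using linear_bounded_pos[OF linear_lin_map, of A] by metis
  show ?thesis
  proof (rule bdd_aboveI2)
    fix X :: "real^'a^'a" assume "X \<in> {X \<in> sym_mats. norm X \<le> 1}"
    thus "norm (lin_map A X) \<le> B" using order_trans[OF B(2) mult_left_mono[of "norm X" 1 B]] B(1) by simp
  qed
qed

lemma lin_map_norm_nonneg: "0 \<le> lin_map_norm A"
proof -
  have "norm (lin_map A 0) \<le> lin_map_norm A"
    unfolding lin_map_norm_def
    by (intro cSUP_upper lin_map_bdd_above) (simp add: subspace_0 subspace_sym_mats)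
  thus ?thesis using norm_ge_zero order_trans by blast
qed

lemma norm_lin_map_le:
  assumes X: "X \<in> sym_mats"
  shows "norm (lin_map A X) \<le> lin_map_norm A * norm X"
proof (cases "X = 0")
  case False
  have "norm (lin_map A (X /\<^sub>R norm X)) \<le> lin_map_norm A"
    unfolding lin_map_norm_def using X False
    by (intro cSUP_upper lin_map_bdd_above) (simp add: subspace_scale subspace_sym_mats)
  thus ?thesis using False by (simp add: linear_scale[OF linear_lin_map] field_simps)
qed (simp add: linear_0[OF linear_lin_map])

text \<open>\<open>lin_map_norm\<close> only sees symmetric matrices; the adjoint takes symmetric
  values, so the usual duality argument may test at \<open>lin_map_adj A y\<close> itself.\<close>

lemma norm_lin_map_adj_le:
  assumes A: "\<And>i. A i \<in> sym_mats"
  shows "norm (lin_map_adj A y) \<le> lin_map_norm A * norm y"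
proof -
  let ?X = "lin_map_adj A y"
  have "norm ?X * norm ?X = y \<bullet> lin_map A ?X"
    by (simp add: inner_lin_map norm_eq_square[symmetric] power2_norm_eq_inner[symmetric] power2_eq_square)
  also have "\<dots> \<le> norm y * norm (lin_map A ?X)" by (rule norm_cauchy_schwarz)
  also have "\<dots> \<le> norm y * (lin_map_norm A * norm ?X)"
    by (intro mult_left_mono norm_lin_map_le lin_map_adj_sym A) simp
  finally have "norm ?X * norm ?X \<le> (lin_map_norm A * norm y) * norm ?X" by (simp add: mult_ac)
  thus ?thesis
    using lin_map_norm_nonneg[of A] by (cases "?X = 0") (auto simp: mult_le_cancel_right)
qed

lemma psd_mats_imp_sym_mats: "X \<in> psd_mats \<Longrightarrow> X \<in> sym_mats"
  by (simp add: psd_mats_def)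

text \<open>The whole line lies in \<open>S\<close>, so differentiability within \<open>S\<close>
  restricts to it and becomes an ordinary one-variable derivative.\<close>

lemma grad_on_line_derivative:
  assumes S: "subspace S" and x: "x \<in> S" "y \<in> S" and g: "g differentiable (at x within S)"
  shows "((\<lambda>t. g (x + t *\<^sub>R (y - x))) has_real_derivative grad_on S g x \<bullet> (y - x)) (at 0)"
proof -
  have line: "((\<lambda>t::real. x + t *\<^sub>R (y - x)) has_derivative (\<lambda>t. t *\<^sub>R (y - x))) (at 0)"
    by (auto intro!: derivative_eq_intros)
  have sub: "range (\<lambda>t::real. x + t *\<^sub>R (y - x)) \<subseteq> S"
    using S x by (auto intro!: subspace_add subspace_scale subspace_diff)
  have "(g has_derivative (\<lambda>h. grad_on S g x \<bullet> h)) (at (x + 0 *\<^sub>R (y - x)) within range (\<lambda>t::real. x + t *\<^sub>R (y - x)))"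
    using has_derivative_subset[OF grad_on_works(2)[OF S x(1) g] sub] by simp
  from has_derivative_in_compose[OF line this]
  show ?thesis by (simp add: has_field_derivative_def mult_commute_abs)
qed

lemma convex_on_grad_inequality:
  assumes S: "subspace S" and x: "x \<in> S" "y \<in> S" and g: "g differentiable (at x within S)"
    and convex: "convex_on S g"
  shows "g x + grad_on S g x \<bullet> (y - x) \<le> g y"
proof -
  have "convex_on UNIV (\<lambda>t. g (x + t *\<^sub>R (y - x)))"
  proof (rule convex_onI)
    fix t a c :: real assume t: "0 < t" "t < 1"
    have "x + ((1 - t) *\<^sub>R a + t *\<^sub>R c) *\<^sub>R (y - x)
        = (1 - t) *\<^sub>R (x + a *\<^sub>R (y - x)) + t *\<^sub>R (x + c *\<^sub>R (y - x))"
      by (simp add: algebra_simps)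
    thus "g (x + ((1 - t) *\<^sub>R a + t *\<^sub>R c) *\<^sub>R (y - x))
        \<le> (1 - t) * g (x + a *\<^sub>R (y - x)) + t * g (x + c *\<^sub>R (y - x))"
      using S x t by (auto intro!: convex_onD[OF convex] subspace_add subspace_scale subspace_diff)
  qed simp
  from convex_on_imp_above_tangent[OF this _ _ _ grad_on_line_derivative[OF S x g], of 1]
  show ?thesis by simp
qed

text \<open>The dual variable is unconstrained, so its plain update also counts as a projection and
  the abstract method applies to the pair.\<close>

lemma is_proj_Times_UNIV:
  assumes "is_proj K x p"
  shows "is_proj (K \<times> UNIV) (x, q) (p, q)"
  using assms by (auto simp: is_proj_def)

text \<open>The maximum in \<open>R\<^sub>0\<close> equals one of its two terms, and
  \<open>eigval_perturbed_nonpos\<close> is applied accordingly with \<open>s = 1\<close> or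
  \<open>s = rt\<close>.\<close>

lemma trunc_certificate:
  fixes P G E :: "real^'n^'n"
  assumes P: "P \<in> psd_mats" and G: "G \<in> psd_mats" and compl: "P \<bullet> G = 0" and \<eta>: "0 < \<eta>"
    and rt: "rt = CARD('n) - rank G" "rt \<le> r"
    and ind: "CARD('n) - r \<in> {1..CARD('n)}" "CARD('n) - r + rt - 1 \<in> {1..CARD('n)}"
    and E: "norm E \<le> \<eta> * max (eigval G (CARD('n) - r)) (sqrt (real rt) * eigval G (CARD('n) - r + rt - 1))"
    and v: "eigen_decomp (P - \<eta> *\<^sub>R G + E) lam v"
  shows "lam (r + 1) \<le> 0"
proof -
  obtain \<mu> g where g: "eigen_decomp G \<mu> g" using spectral_theorem[OF psd_mats_imp_sym_mats[OF G]] .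
  note ev = eigval_eq[OF g ind(1)] eigval_eq[OF g ind(2)]
  have r: "r < CARD('n)" using ind by auto
  \<comment> \<open>\<open>rt \<le> r\<close> means that index \<open>n - r\<close> is at most the
    rank of \<open>G\<close>.\<close>
  have pos: "0 < \<mu> (CARD('n) - r)" using rt r by (intro eigval_psd_pos[OF g G]) auto
  show ?thesis
  proof (cases "sqrt (real rt) * \<mu> (CARD('n) - r + rt - 1) \<le> \<mu> (CARD('n) - r)")
    case True
    with E have "norm E \<le> \<eta> * (sqrt (real 1) * \<mu> (CARD('n) - r))" unfolding ev by (simp add: max_def)
    from eigval_perturbed_nonpos[OF P G compl \<eta> g v order_refl r _ _ _ this] pos
    show ?thesis by simp
  next
    case False
    hence big: "0 < sqrt (real rt) * \<mu> (CARD('n) - r + rt - 1)" using pos by linarith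
    hence s: "1 \<le> rt" by (cases rt) auto
    hence "0 < \<mu> (CARD('n) - r + rt - 1)" using big by (simp add: zero_less_mult_iff)
    moreover have "norm E \<le> \<eta> * (sqrt (real rt) * \<mu> (CARD('n) - r + rt - 1))"
      using E False unfolding ev by (simp add: max_def)
    ultimately show ?thesis
      using eigval_perturbed_nonpos[OF P G compl \<eta> g v s r refl] ind(2) by simp
  qed
qed

section \<open>The saddle operator of the semidefinite program\<close>

locale psd_program =
  fixes f :: "real^'n^'n \<Rightarrow> real" and A :: "'m::finite \<Rightarrow> real^'n^'n" and b :: "real^'m"
    and \<beta> \<eta> :: real
  assumes f_convex: "convex_on sym_mats f"
    and f_smooth: "smooth_on \<beta> sym_mats f"
    and A_sym: "\<And>i. A i \<in> sym_mats"
    and \<eta>_pos: "0 < \<eta>"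
    and \<eta>_le: "\<eta> \<le> 1 / sqrt (2 * (\<beta>\<^sup>2 + (lin_map_norm A)\<^sup>2))"
begin

abbreviation df :: "real^'n^'n \<Rightarrow> real^'n^'n" where "df \<equiv> grad_on sym_mats f"
abbreviation opnorm :: real where "opnorm \<equiv> lin_map_norm A"
abbreviation cone :: "((real^'n^'n) \<times> (real^'m)) set" where "cone \<equiv> psd_mats \<times> UNIV"

definition lip_const :: real where "lip_const = \<eta> * sqrt (2 * (\<beta>\<^sup>2 + opnorm\<^sup>2))"

definition saddle_op :: "(real^'n^'n) \<times> (real^'m) \<Rightarrow> (real^'n^'n) \<times> (real^'m)" where
  "saddle_op p = \<eta> *\<^sub>R (df (fst p) - lin_map_adj A (snd p), lin_map A (fst p) - b)"

lemma saddle_op_Pair: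
  "saddle_op (X, y) = (\<eta> *\<^sub>R (df X - lin_map_adj A y), \<eta> *\<^sub>R (lin_map A X - b))"
  by (simp add: saddle_op_def)

lemma f_differentiable: "X \<in> sym_mats \<Longrightarrow> f differentiable (at X within sym_mats)"
  using f_smooth by (simp add: smooth_on_def differentiable_on_def)

lemma df_sym: "X \<in> sym_mats \<Longrightarrow> df X \<in> sym_mats"
  by (intro grad_on_works(1) subspace_sym_mats f_differentiable)

lemma grad_X_df: "X \<in> sym_mats \<Longrightarrow> grad_X f A b X y = df X - lin_map_adj A y"
  using f_smooth by (intro grad_X_eq A_sym) (simp_all add: smooth_on_def)

lemma \<beta>_nonneg: "0 \<le> \<beta>"
  using f_smooth by (auto simp: smooth_on_def lipschitz_on_def)

lemma df_lipschitz:
  assumes "X \<in> sym_mats" "Y \<in> sym_mats"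
  shows "norm (df X - df Y) \<le> \<beta> * norm (X - Y)"
  using f_smooth assms by (auto simp: smooth_on_def lipschitz_on_def dist_norm)

lemma f_tangent:
  assumes "X \<in> sym_mats" "Y \<in> sym_mats"
  shows "f X + df X \<bullet> (Y - X) \<le> f Y"
  using assms by (intro convex_on_grad_inequality subspace_sym_mats f_differentiable f_convex)

lemma lip_const_nonneg: "0 \<le> lip_const"
  using \<eta>_pos by (simp add: lip_const_def)

lemma lip_const_le_1: "lip_const \<le> 1"
proof (cases "sqrt (2 * (\<beta>\<^sup>2 + opnorm\<^sup>2)) = 0")
  case False
  moreover have "0 \<le> sqrt (2 * (\<beta>\<^sup>2 + opnorm\<^sup>2))" by simp
  ultimately have "0 < sqrt (2 * (\<beta>\<^sup>2 + opnorm\<^sup>2))" by linarith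
  thus ?thesis using \<eta>_le unfolding lip_const_def by (simp only: pos_le_divide_eq)
qed (simp only: lip_const_def mult_zero_right zero_le_one)

lemma norm_grad_diff_le:
  assumes "X \<in> sym_mats" "X' \<in> sym_mats"
  shows "norm ((df X - lin_map_adj A y) - (df X' - lin_map_adj A y'))
           \<le> \<beta> * norm (X - X') + opnorm * norm (y - y')"
proof -
  have "(df X - lin_map_adj A y) - (df X' - lin_map_adj A y') = (df X - df X') - lin_map_adj A (y - y')"
    by (simp add: lin_map_adj_diff)
  also have "norm \<dots> \<le> norm (df X - df X') + norm (lin_map_adj A (y - y'))"
    by (rule norm_triangle_ineq4)
  also have "\<dots> \<le> \<beta> * norm (X - X') + opnorm * norm (y - y')"
    by (intro add_mono df_lipschitz norm_lin_map_adj_le A_sym assms)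
  finally show ?thesis .
qed

text \<open>A sum of two norms is at most \<open>sqrt 2\<close> times the norm of the pair; this is
  the source of \<open>sqrt 2 * \<eta> * max \<beta> opnorm\<close> in
  \<open>R\<^sub>0\<close>.\<close>

lemma norm_grad_diff_le_Pair:
  assumes "X \<in> sym_mats" "X' \<in> sym_mats"
  shows "norm ((df X - lin_map_adj A y) - (df X' - lin_map_adj A y'))
           \<le> sqrt 2 * max \<beta> opnorm * norm ((X, y) - (X', y'))"
proof -
  have "norm (X - X') + norm (y - y') \<le> sqrt 2 * norm ((X, y) - (X', y'))"
  proof (rule power2_le_imp_le)
    have "0 \<le> (norm (X - X') - norm (y - y'))\<^sup>2" by simp
    hence "(norm (X - X') + norm (y - y'))\<^sup>2 \<le> 2 * ((norm (X - X'))\<^sup>2 + (norm (y - y'))\<^sup>2)"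
      by (simp add: power2_eq_square algebra_simps)
    thus "(norm (X - X') + norm (y - y'))\<^sup>2 \<le> (sqrt 2 * norm ((X, y) - (X', y')))\<^sup>2"
      by (simp add: norm_Pair power_mult_distrib)
  qed simp
  hence "max \<beta> opnorm * (norm (X - X') + norm (y - y'))
      \<le> max \<beta> opnorm * (sqrt 2 * norm ((X, y) - (X', y')))"
    using \<beta>_nonneg by (intro mult_left_mono) auto
  moreover have "\<beta> * norm (X - X') + opnorm * norm (y - y')
      \<le> max \<beta> opnorm * norm (X - X') + max \<beta> opnorm * norm (y - y')"
    by (intro add_mono mult_right_mono) auto
  ultimately show ?thesis using norm_grad_diff_le[OF assms, of y y'] by (simp add: algebra_simps)
qed

sublocale monotone_lipschitz cone saddle_op lip_const
proof
  fix p q assume p: "p \<in> cone" and q: "q \<in> cone"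
  obtain X y X' y' where pq: "p = (X, y)" "q = (X', y')" by fastforce
  have X: "X \<in> sym_mats" "X' \<in> sym_mats" using p q by (auto simp: pq psd_mats_imp_sym_mats)
  define D where "D = norm (X - X')"
  define e where "e = norm (y - y')"
  \<comment> \<open>The bilinear coupling of primal and dual parts cancels by adjointness, leaving
    the monotonicity of the gradient of \<open>f\<close>.\<close>
  have "(saddle_op p - saddle_op q) \<bullet> (p - q)
      = \<eta> * ((df X - df X') \<bullet> (X - X') - lin_map_adj A (y - y') \<bullet> (X - X')
             + (y - y') \<bullet> lin_map A (X - X'))"
    by (simp add: pq saddle_op_Pair lin_map_adj_diff linear_diff[OF linear_lin_map] inner_simps
        inner_commute algebra_simps)
  also have "\<dots> = \<eta> * ((df X - df X') \<bullet> (X - X'))" by (simp add: inner_lin_map)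
  finally have eq: "(saddle_op p - saddle_op q) \<bullet> (p - q) = \<eta> * ((df X - df X') \<bullet> (X - X'))" .
  have "0 \<le> (df X - df X') \<bullet> (X - X')"
    using f_tangent[OF X] f_tangent[OF X(2,1)] by (simp add: inner_simps)
  thus "0 \<le> (saddle_op p - saddle_op q) \<bullet> (p - q)" unfolding eq using \<eta>_pos by simp
  have "saddle_op p - saddle_op q
      = \<eta> *\<^sub>R ((df X - lin_map_adj A y) - (df X' - lin_map_adj A y'), lin_map A (X - X'))"
    by (simp add: pq saddle_op_Pair linear_diff[OF linear_lin_map] algebra_simps)
  hence "(norm (saddle_op p - saddle_op q))\<^sup>2
      = \<eta>\<^sup>2 * ((norm ((df X - lin_map_adj A y) - (df X' - lin_map_adj A y')))\<^sup>2
               + (norm (lin_map A (X - X')))\<^sup>2)"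
    by (simp only: norm_scaleR norm_Pair) (simp add: power_mult_distrib)
  also have "\<dots> \<le> \<eta>\<^sup>2 * ((\<beta> * D + opnorm * e)\<^sup>2 + (opnorm * D)\<^sup>2)"
    unfolding D_def e_def using X
    by (intro mult_left_mono add_mono power_mono norm_grad_diff_le norm_lin_map_le
        subspace_diff subspace_sym_mats) auto
  also have "\<dots> \<le> \<eta>\<^sup>2 * (2 * (\<beta>\<^sup>2 + opnorm\<^sup>2) * (D\<^sup>2 + e\<^sup>2))"
  proof (rule mult_left_mono)
    \<comment> \<open>The right side minus the left side is the first square plus twice the second
      plus the third.\<close>
    have "0 \<le> (\<beta> * D - opnorm * e)\<^sup>2" "0 \<le> (\<beta> * e)\<^sup>2" "0 \<le> (opnorm * D)\<^sup>2" by auto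
    thus "(\<beta> * D + opnorm * e)\<^sup>2 + (opnorm * D)\<^sup>2 \<le> 2 * (\<beta>\<^sup>2 + opnorm\<^sup>2) * (D\<^sup>2 + e\<^sup>2)"
      by (simp add: power2_eq_square algebra_simps)
  qed simp
  also have "\<dots> = (lip_const * norm (p - q))\<^sup>2"
    by (simp add: lip_const_def D_def e_def pq norm_Pair power_mult_distrib)
  finally show "norm (saddle_op p - saddle_op q) \<le> lip_const * norm (p - q)"
    by (rule power2_le_imp_le) (use lip_const_nonneg in simp)
qed (use lip_const_nonneg lip_const_le_1 in auto)

text \<open>Convexity handles \<open>f\<close>, and feasibility of \<open>X\<close> cancels the
  terms with \<open>w\<close>. The comparison multiplier \<open>y'\<close> stays free, and its later
  choices yield the objective and the constraint bounds.\<close>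

lemma saddle_op_gap:
  assumes "Z \<in> psd_mats" "X \<in> psd_mats" "lin_map A X = b"
  shows "\<eta> * (f Z - f X + y' \<bullet> (b - lin_map A Z)) \<le> saddle_op (Z, w) \<bullet> ((Z, w) - (X, y'))"
proof -
  have "f Z - f X \<le> df Z \<bullet> (Z - X)"
    using f_tangent[of Z X] assms by (simp add: psd_mats_imp_sym_mats inner_diff_right)
  moreover have "w \<bullet> (lin_map A Z - b) = lin_map_adj A w \<bullet> (Z - X)"
    by (simp add: assms(3)[symmetric] linear_diff[OF linear_lin_map, symmetric] inner_lin_map)
  moreover have "saddle_op (Z, w) \<bullet> ((Z, w) - (X, y'))
      = \<eta> * (df Z \<bullet> (Z - X) - lin_map_adj A w \<bullet> (Z - X) + w \<bullet> (lin_map A Z - b) + y' \<bullet> (b - lin_map A Z))"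
    by (simp add: saddle_op_Pair inner_simps inner_commute algebra_simps)
  ultimately show ?thesis using \<eta>_pos by simp
qed

end

section \<open>Optimality conditions and reduction to the abstract method\<close>

locale psd_program_run = psd_program f A b \<beta> \<eta>
  for f :: "real^'n^'n \<Rightarrow> real" and A :: "'m::finite \<Rightarrow> real^'n^'n" and b :: "real^'m"
    and \<beta> \<eta> :: real +
  fixes X Z :: "nat \<Rightarrow> real^'n^'n" and y w :: "nat \<Rightarrow> real^'m"
    and Xs :: "real^'n^'n" and ys :: "real^'m"
  assumes sequences: "extragradient psd_proj f A b \<eta> X y Z w"
    and dual: "saddle_point f A b Xs ys" and feasible: "lin_map A Xs = b"
begin

lemma Z_psd: "1 \<le> t \<Longrightarrow> Z (t + 1) \<in> psd_mats"
  using sequences by (auto simp: extragradient_def psd_proj_iff is_proj_def)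

lemma X_psd: "1 \<le> t \<Longrightarrow> X t \<in> psd_mats"
  by (induction t rule: dec_induct)
    (use sequences in \<open>auto simp: extragradient_def psd_proj_iff is_proj_def\<close>)

lemma Xs_psd: "Xs \<in> psd_mats"
  using dual by (simp add: saddle_point_def)

abbreviation Gs :: "real^'n^'n" where "Gs \<equiv> df Xs - lin_map_adj A ys"

lemma Gs_sym: "Gs \<in> sym_mats"
  using Xs_psd by (intro subspace_diff subspace_sym_mats df_sym lin_map_adj_sym A_sym psd_mats_imp_sym_mats)

lemma Gs_optimality:
  assumes Q: "Q \<in> psd_mats"
  shows "0 \<le> Gs \<bullet> (Q - Xs)"
proof (rule ccontr)
  assume neg: "\<not> 0 \<le> Gs \<bullet> (Q - Xs)"
  \<comment> \<open>The Lagrangian at \<open>ys\<close> along the segment from \<open>Xs\<close> to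
    \<open>Q\<close>, up to an additive constant; a negative derivative at 0 would contradict
    minimality of \<open>Xs\<close>.\<close>
  define \<phi> where "\<phi> t = f (Xs + t *\<^sub>R (Q - Xs)) - t * (lin_map_adj A ys \<bullet> (Q - Xs))" for t
  have "(\<phi> has_real_derivative df Xs \<bullet> (Q - Xs) - lin_map_adj A ys \<bullet> (Q - Xs)) (at 0)"
    unfolding \<phi>_def using Xs_psd Q
    by (auto intro!: derivative_eq_intros grad_on_line_derivative subspace_sym_mats f_differentiable
        simp: psd_mats_imp_sym_mats)
  hence "(\<phi> has_real_derivative Gs \<bullet> (Q - Xs)) (at 0)" by (simp add: inner_diff_left)
  from DERIV_neg_dec_right[OF this] neg obtain d
    where d: "0 < d" "\<And>h. 0 < h \<Longrightarrow> h < d \<Longrightarrow> \<phi> h < \<phi> 0" by auto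
  define h where "h = min (d / 2) 1"
  have h: "0 < h" "h < d" "h \<le> 1" using d(1) by (auto simp: h_def)
  have "Xs + h *\<^sub>R (Q - Xs) = (1 - h) *\<^sub>R Xs + h *\<^sub>R Q" by (simp add: algebra_simps)
  hence "Xs + h *\<^sub>R (Q - Xs) \<in> psd_mats"
    using convexD_alt[OF convex_psd_mats Xs_psd Q] h by simp
  hence "lagrangian f A b Xs ys \<le> lagrangian f A b (Xs + h *\<^sub>R (Q - Xs)) ys"
    using dual by (simp add: saddle_point_def)
  hence "\<phi> 0 \<le> \<phi> h"
    by (simp add: lagrangian_def \<phi>_def inner_diff_right inner_lin_map inner_add_right)
  with d(2)[OF h(1,2)] show False by simp
qed

text \<open>In a cone the optimality condition may be tested at \<open>2 *\<^sub>R Xs\<close> and at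
  \<open>0\<close>, which gives both signs.\<close>

lemma Gs_compl: "Xs \<bullet> Gs = 0"
proof -
  have "2 *\<^sub>R Xs \<in> psd_mats"
    using Xs_psd by (auto simp: psd_mats_def subspace_scale subspace_sym_mats
        scaleR_matrix_vector_assoc[symmetric])
  from Gs_optimality[OF this] Gs_optimality[OF zero_in_psd_mats]
  show ?thesis by (simp add: inner_commute inner_simps scaleR_2)
qed

text \<open>Adding \<open>outer u\<close> to \<open>Xs\<close> stays in the cone, and pairing with
  \<open>outer u\<close> reads off the form at \<open>u\<close>.\<close>

lemma Gs_psd: "Gs \<in> psd_mats"
proof -
  have "0 \<le> u \<bullet> (Gs *v u)" for u
  proof -
    have "Xs + outer u \<in> psd_mats"
      using Xs_psd by (auto simp: psd_mats_def subspace_add subspace_sym_mats outer_in_sym_mats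
          matrix_vector_mult_add_rdistrib outer_mult_vec inner_add_right inner_commute)
    from Gs_optimality[OF this] show ?thesis by (simp add: inner_outer)
  qed
  thus ?thesis using Gs_sym by (simp add: psd_mats_def)
qed

sublocale extragradient_solution cone saddle_op lip_const "\<lambda>t. (X t, y t)" "\<lambda>t. (Z t, w t)" "(Xs, ys)"
proof
  show "(X 1, y 1) \<in> cone" using X_psd[of 1] by simp
  show "(Xs, ys) \<in> cone" using Xs_psd by simp
  show "0 \<le> saddle_op (Xs, ys) \<bullet> (q - (Xs, ys))" if "q \<in> cone" for q
    using Gs_optimality that \<eta>_pos by (auto simp: saddle_op_Pair feasible)
next
  fix t :: nat assume t: "1 \<le> t"
  have proj: "is_proj psd_mats (X t - \<eta> *\<^sub>R (df (X t) - lin_map_adj A (y t))) (Z (t + 1))"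
      "is_proj psd_mats (X t - \<eta> *\<^sub>R (df (Z (t + 1)) - lin_map_adj A (w (t + 1)))) (X (t + 1))"
    and wy: "w (t + 1) = y t + \<eta> *\<^sub>R (b - lin_map A (X t))"
      "y (t + 1) = y t + \<eta> *\<^sub>R (b - lin_map A (Z (t + 1)))"
    using sequences t X_psd[OF t] Z_psd[OF t]
    unfolding extragradient_def psd_proj_iff grad_y_eq by (metis grad_X_df psd_mats_imp_sym_mats)+
  have eq: "y t - \<eta> *\<^sub>R (lin_map A Q - b) = y t + \<eta> *\<^sub>R (b - lin_map A Q)" for Q
    by (simp add: algebra_simps)
  show "is_proj cone ((X t, y t) - saddle_op (X t, y t)) (Z (t + 1), w (t + 1))"
    using is_proj_Times_UNIV[OF proj(1), of "w (t + 1)"] by (simp only: saddle_op_Pair wy eq diff_Pair)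
  show "is_proj cone ((X t, y t) - saddle_op (Z (t + 1), w (t + 1))) (X (t + 1), y (t + 1))"
    using is_proj_Times_UNIV[OF proj(2), of "y (t + 1)"] by (simp only: saddle_op_Pair wy eq diff_Pair)
qed

end

context psd_program_run
begin

section \<open>Correctness of truncation and convergence rates\<close>

abbreviation dist1 :: real where "dist1 \<equiv> norm ((X 1, y 1) - (Xs, ys))"

lemma dist_u_le:
  assumes "1 \<le> t"
  shows "norm ((Z (t + 1), w (t + 1)) - (Xs, ys)) \<le> 2 * dist1"
proof (rule power2_le_imp_le)
  have "(norm ((Z (t + 1), w (t + 1)) - (Xs, ys)))\<^sup>2 \<le> (1 + lip_const\<^sup>2) * dist1\<^sup>2"
    by (rule dist_u[OF assms])
  also have "\<dots> \<le> 4 * dist1\<^sup>2"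
  proof (rule mult_right_mono)
    have "lip_const\<^sup>2 \<le> 1" using lip_const_nonneg lip_const_le_1 by (simp add: power_le_one)
    thus "1 + lip_const\<^sup>2 \<le> 4" by simp
  qed simp
  finally show "(norm ((Z (t + 1), w (t + 1)) - (Xs, ys)))\<^sup>2 \<le> (2 * dist1)\<^sup>2"
    by (simp add: power_mult_distrib)
qed simp

text \<open>The gradient point \<open>(Q, q)\<close> is kept general because each iteration projects
  twice, with the gradient at \<open>(X t, y t)\<close> and at
  \<open>(Z (t + 1), w (t + 1))\<close>.\<close>

lemma trunc_iff_proj:
  assumes rt: "rt = CARD('n) - rank Gs" "rt \<le> r"
    and ind: "CARD('n) - r \<in> {1..CARD('n)}" "CARD('n) - r + rt - 1 \<in> {1..CARD('n)}"
    and R0: "R\<^sub>0 = \<eta> * max (eigval Gs (CARD('n) - r)) (sqrt (real rt) * eigval Gs (CARD('n) - r + rt - 1))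
      / (2 * (1 + sqrt 2 * \<eta> * max \<beta> opnorm))"
    and init: "dist1 \<le> R\<^sub>0"
    and t: "1 \<le> t" and Q: "Q \<in> psd_mats" and q: "norm ((Q, q) - (Xs, ys)) \<le> 2 * dist1"
  shows "trunc_psd_proj r (X t - \<eta> *\<^sub>R grad_X f A b Q q) Y
    \<longleftrightarrow> psd_proj (X t - \<eta> *\<^sub>R grad_X f A b Q q) Y"
proof (rule trunc_psd_proj_iff)
  let ?M = "X t - \<eta> *\<^sub>R grad_X f A b Q q"
  note sym = psd_mats_imp_sym_mats[OF Q] psd_mats_imp_sym_mats[OF Xs_psd] psd_mats_imp_sym_mats[OF X_psd[OF t]]
  have M: "?M = X t - \<eta> *\<^sub>R (df Q - lin_map_adj A q)" by (simp add: grad_X_df sym)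
  show "?M \<in> sym_mats" unfolding M
    by (intro subspace_diff subspace_scale subspace_sym_mats sym df_sym lin_map_adj_sym A_sym)
  show "r < CARD('n)" using ind(1) by auto
  fix lam v assume v: "eigen_decomp ?M lam v"
  define E where "E = (X t - Xs) - \<eta> *\<^sub>R ((df Q - lin_map_adj A q) - Gs)"
  have ME: "?M = Xs - \<eta> *\<^sub>R Gs + E" unfolding M E_def by (simp add: algebra_simps)
  let ?c = "sqrt 2 * \<eta> * max \<beta> opnorm"
  have c: "0 \<le> ?c" using \<eta>_pos \<beta>_nonneg by simp
  have "norm (X t - Xs) \<le> norm ((X t, y t) - (Xs, ys))"
    using norm_fst_le[of "X t - Xs" "y t - ys"] by simp
  also have "\<dots> \<le> dist1" by (rule dist_z[OF t])
  finally have 1: "norm (X t - Xs) \<le> dist1" .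
  have "norm ((df Q - lin_map_adj A q) - Gs) \<le> sqrt 2 * max \<beta> opnorm * norm ((Q, q) - (Xs, ys))"
    by (rule norm_grad_diff_le_Pair[OF sym(1,2)])
  also have "\<dots> \<le> sqrt 2 * max \<beta> opnorm * (2 * dist1)"
    using \<beta>_nonneg by (intro mult_left_mono q) simp
  finally have "\<eta> * norm ((df Q - lin_map_adj A q) - Gs) \<le> \<eta> * (sqrt 2 * max \<beta> opnorm * (2 * dist1))"
    using \<eta>_pos by (intro mult_left_mono) auto
  hence 2: "norm (\<eta> *\<^sub>R ((df Q - lin_map_adj A q) - Gs)) \<le> ?c * (2 * dist1)"
    using \<eta>_pos by (simp add: mult_ac)
  \<comment> \<open>Displacement of the iterate plus displacement of the gradient; rounding
    \<open>1 + 2 * ?c\<close> up to \<open>2 * (1 + ?c)\<close> matches the denominator of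
    \<open>R\<^sub>0\<close>.\<close>
  have "norm E \<le> dist1 + ?c * (2 * dist1)"
    unfolding E_def using norm_triangle_ineq4 1 2 by (rule order_trans[OF _ add_mono])
  also have "\<dots> \<le> (2 * (1 + ?c)) * dist1" by (simp add: algebra_simps)
  also have "\<dots> \<le> (2 * (1 + ?c)) * R\<^sub>0" using c by (intro mult_left_mono init) simp
  also have "\<dots> = \<eta> * max (eigval Gs (CARD('n) - r)) (sqrt (real rt) * eigval Gs (CARD('n) - r + rt - 1))"
    unfolding R0 using c by simp
  finally show "lam (r + 1) \<le> 0"
    using v unfolding ME by (rule trunc_certificate[OF Xs_psd Gs_psd Gs_compl \<eta>_pos rt ind])
qed

text \<open>Jensen's inequality for \<open>f\<close> and linearity of the constraint reduce the gap
  of the average to the sum of gaps, which \<open>energy\<close> with comparison point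
  \<open>(Xs, q)\<close> bounds for every \<open>q\<close>.\<close>

lemma average_gap:
  assumes T: "1 \<le> T"
  defines "Zb \<equiv> (1 / real T) *\<^sub>R (\<Sum>t=1..T. Z (t + 1))"
  shows "f Zb - f Xs + q \<bullet> (b - lin_map A Zb)
           \<le> ((norm (X 1 - Xs))\<^sup>2 + (norm (y 1 - q))\<^sup>2) / (2 * \<eta> * real T)"
proof -
  let ?g = "\<lambda>t. f (Z (t + 1)) - f Xs + q \<bullet> (b - lin_map A (Z (t + 1)))"
  let ?u = "\<lambda>t. (Z (t + 1), w (t + 1))"
  have Zb: "Zb = (\<Sum>t=1..T. (1 / real T) *\<^sub>R Z (t + 1))" by (simp add: Zb_def scaleR_sum_right)
  have "f Zb \<le> (\<Sum>t=1..T. 1 / real T * f (Z (t + 1)))"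
    unfolding Zb using T by (intro convex_on_sum[OF _ _ f_convex]) (auto intro!: psd_mats_imp_sym_mats Z_psd[simplified])
  hence "real T * f Zb \<le> (\<Sum>t=1..T. f (Z (t + 1)))"
    using T by (simp add: sum_divide_distrib[symmetric] field_simps)
  moreover have "real T * (q \<bullet> lin_map A Zb) = (\<Sum>t=1..T. q \<bullet> lin_map A (Z (t + 1)))"
    using T unfolding Zb_def
    by (simp add: linear_scale[OF linear_lin_map] linear_sum[OF linear_lin_map] inner_sum_right)
  ultimately have "real T * (f Zb - f Xs + q \<bullet> (b - lin_map A Zb)) \<le> (\<Sum>t=1..T. ?g t)"
    by (simp add: sum.distrib sum_subtractf inner_diff_right algebra_simps)
  hence "2 * \<eta> * (real T * (f Zb - f Xs + q \<bullet> (b - lin_map A Zb))) \<le> 2 * (\<Sum>t=1..T. \<eta> * ?g t)"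
    using \<eta>_pos by (simp add: sum_distrib_left[symmetric])
  also have "\<dots> \<le> 2 * (\<Sum>t=1..T. saddle_op (?u t) \<bullet> (?u t - (Xs, q)))"
    by (intro mult_left_mono sum_mono saddle_op_gap Z_psd Xs_psd feasible) auto
  also have "\<dots> \<le> (norm ((X 1, y 1) - (Xs, q)))\<^sup>2"
  proof -
    have "0 \<le> (1 - lip_const\<^sup>2) * (\<Sum>t=1..T. (norm ((X t, y t) - ?u t))\<^sup>2)"
      using lip_const_nonneg lip_const_le_1
      by (intro mult_nonneg_nonneg sum_nonneg) (auto simp: power_le_one)
    moreover have "0 \<le> (norm ((X (T + 1), y (T + 1)) - (Xs, q)))\<^sup>2" by simp
    moreover have "(Xs, q) \<in> cone" using Xs_psd by simp
    ultimately show ?thesis using energy[of "(Xs, q)" T] by linarith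
  qed
  also have "\<dots> = (norm (X 1 - Xs))\<^sup>2 + (norm (y 1 - q))\<^sup>2" by (simp add: norm_Pair)
  finally show ?thesis using T \<eta>_pos by (simp add: field_simps)
qed

lemma saddle_lower_bound:
  assumes "Q \<in> psd_mats"
  shows "f Xs \<le> f Q + ys \<bullet> (b - lin_map A Q)"
  using dual assms by (auto simp: saddle_point_def lagrangian_def feasible)

lemma average_rate:
  assumes T: "1 \<le> T"
    and Rsq: "Rsq = (norm (X 1 - Xs))\<^sup>2 +
      (SUP y'\<in>{y'. norm y' \<le> 2 * norm ys}. (norm (y 1 - y'))\<^sup>2)"
  defines "Zb \<equiv> (1 / real T) *\<^sub>R (\<Sum>t=1..T. Z (t + 1))"
  shows "f Zb - f Xs \<le> Rsq / (2 * \<eta> * real T)"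
    and "ys \<noteq> 0 \<Longrightarrow> norm (lin_map A Zb - b) \<le> Rsq / (2 * norm ys * \<eta> * real T)"
proof -
  \<comment> \<open>Boundedness lets each admissible \<open>q\<close> be compared with the supremum
    in \<open>Rsq\<close>.\<close>
  have bdd: "bdd_above ((\<lambda>y'. (norm (y 1 - y'))\<^sup>2) ` {y'. norm y' \<le> 2 * norm ys})"
  proof (rule bdd_aboveI2)
    fix y' :: "real^'m" assume y': "y' \<in> {y'. norm y' \<le> 2 * norm ys}"
    have "norm (y 1 - y') \<le> norm (y 1) + 2 * norm ys"
      using norm_triangle_ineq4[of "y 1" y'] y' by simp
    thus "(norm (y 1 - y'))\<^sup>2 \<le> (norm (y 1) + 2 * norm ys)\<^sup>2" by (rule power_mono) simp
  qed
  have gap: "f Zb - f Xs + q \<bullet> (b - lin_map A Zb) \<le> Rsq / (2 * \<eta> * real T)"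
    if q: "norm q \<le> 2 * norm ys" for q
  proof -
    have "(norm (y 1 - q))\<^sup>2 \<le> (SUP y'\<in>{y'. norm y' \<le> 2 * norm ys}. (norm (y 1 - y'))\<^sup>2)"
      using q by (intro cSUP_upper bdd) simp
    hence "((norm (X 1 - Xs))\<^sup>2 + (norm (y 1 - q))\<^sup>2) / (2 * \<eta> * real T) \<le> Rsq / (2 * \<eta> * real T)"
      unfolding Rsq using \<eta>_pos by (intro divide_right_mono) auto
    thus ?thesis using average_gap[OF T, of q] unfolding Zb_def by linarith
  qed
  from gap[of 0] show "f Zb - f Xs \<le> Rsq / (2 * \<eta> * real T)" by simp
  assume ys: "ys \<noteq> 0"
  let ?v = "b - lin_map A Zb"
  have "Zb = (\<Sum>t=1..T. (1 / real T) *\<^sub>R Z (t + 1))" by (simp add: Zb_def scaleR_sum_right)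
  also have "\<dots> \<in> psd_mats"
    using T by (intro convex_sum convex_psd_mats) (auto intro!: Z_psd[simplified])
  finally have "f Xs \<le> f Zb + ys \<bullet> ?v" by (rule saddle_lower_bound)
  moreover have "ys \<bullet> ?v \<le> norm ys * norm ?v" by (rule norm_cauchy_schwarz)
  moreover have "sgn ?v \<bullet> ?v = norm ?v"
    by (cases "?v = 0") (simp_all add: sgn_div_norm power2_norm_eq_inner[symmetric] power2_eq_square)
  \<comment> \<open>This multiplier, of norm at most \<open>2 * norm ys\<close>, is aligned with the
    violation \<open>?v\<close> and adds \<open>2 * norm ys * norm ?v\<close>. The saddle point
    bounds the objective gap below by \<open>- norm ys * norm ?v\<close>, so one copy
    survives.\<close>
  moreover have "f Zb - f Xs + ((2 * norm ys) *\<^sub>R sgn ?v) \<bullet> ?v \<le> Rsq / (2 * \<eta> * real T)"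
    by (intro gap) (simp add: norm_sgn)
  ultimately have "norm ys * norm ?v \<le> Rsq / (2 * \<eta> * real T)" by simp
  thus "norm (lin_map A Zb - b) \<le> Rsq / (2 * norm ys * \<eta> * real T)"
    using ys T \<eta>_pos by (simp add: norm_minus_commute field_simps)
qed

text \<open>The residual \<open>\<rho>\<close> at the half step is small by
  \<open>last_iterate\<close>. Pairing it with the offset from \<open>(Xs, 0)\<close> bounds the
  objective gap, and its dual component is \<open>\<eta>\<close> times the constraint
  violation.\<close>

lemma last_iterate_rate:
  assumes T: "1 \<le> T" and \<eta>: "\<eta> = 1 / (2 * sqrt (\<beta>\<^sup>2 + opnorm\<^sup>2))" and init: "dist1 \<le> R\<^sub>0"
    and R1: "R\<^sub>1 = 3 * sqrt 2 * max (2 * R\<^sub>0) (3 * norm ys) * dist1"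
  shows "f (Z (T + 1)) - f Xs \<le> R\<^sub>1 / (\<eta> * sqrt (real T))"
    and "ys \<noteq> 0 \<Longrightarrow> norm (lin_map A (Z (T + 1)) - b) \<le> R\<^sub>1 / (norm ys * \<eta> * sqrt (real T))"
proof -
  \<comment> \<open>If the root were 0, the quotient defining \<open>\<eta>\<close> would be 0 by
    the convention \<open>x / 0 = 0\<close>.\<close>
  have "0 < sqrt (\<beta>\<^sup>2 + opnorm\<^sup>2)" using \<eta>_pos \<eta> by (simp add: zero_less_divide_iff)
  moreover have "\<eta>\<^sup>2 = 1 / (4 * (\<beta>\<^sup>2 + opnorm\<^sup>2))"
    by (subst \<eta>) (simp add: power_mult_distrib power_divide)
  ultimately have L: "lip_const\<^sup>2 = 1 / 2"
    by (simp add: lip_const_def power_mult_distrib)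
  let ?u = "(Z (T + 1), w (T + 1))"
  define d where "d = (X T, y T) - saddle_op (X T, y T) - ?u"
  define \<rho> where "\<rho> = saddle_op ?u + d"
  define m where "m = max (2 * R\<^sub>0) (3 * norm ys)"
  define S where "S = sqrt 2 * dist1 / sqrt (real T)"
  have R1S: "R\<^sub>1 / sqrt (real T) = 3 * m * S" by (simp add: R1 m_def S_def)
  have S: "0 \<le> S" by (simp add: S_def)
  have \<rho>: "norm \<rho> \<le> 45 / 16 * S"
    using last_iterate[OF T L] by (simp add: \<rho>_def d_def S_def del: diff_Pair)
  \<comment> \<open>The dual variable is unconstrained, so the normal vector has no dual
    part.\<close>
  have d_snd: "snd d = 0"
    using sequences T unfolding extragradient_def grad_y_eq
    by (simp add: d_def saddle_op_Pair algebra_simps)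
  have D0: "0 \<le> dist1" by simp
  have ZK: "Z (T + 1) \<in> psd_mats" by (rule Z_psd[OF T])

  have "(norm (?u - (Xs, ys)))\<^sup>2 \<le> (1 + lip_const\<^sup>2) * dist1\<^sup>2" by (rule dist_u[OF T])
  also have "\<dots> \<le> (5 / 4 * dist1)\<^sup>2"
    unfolding L power_mult_distrib by (intro mult_right_mono) (simp_all add: power_divide)
  finally have "norm (?u - (Xs, ys)) \<le> 5 / 4 * dist1" by (rule power2_le_imp_le) simp
  moreover have "norm (?u - (Xs, 0)) \<le> norm (?u - (Xs, ys)) + norm ys"
    using norm_triangle_ineq[of "?u - (Xs, ys)" "(0, ys)"] by (simp add: norm_Pair)
  moreover have "2 * R\<^sub>0 \<le> m" "3 * norm ys \<le> m" by (auto simp: m_def)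
  \<comment> \<open>\<open>5/4 * dist1\<close> is at most \<open>5/8 * m\<close> and
    \<open>norm ys\<close> at most \<open>1/3 * m\<close>; the coefficients add up to
    \<open>23/24\<close>.\<close>
  ultimately have "norm (?u - (Xs, 0)) \<le> 23 / 24 * m" using init by linarith
  have m: "0 \<le> m" using init D0 unfolding m_def by linarith

  have "\<eta> * (f (Z (T + 1)) - f Xs) \<le> saddle_op ?u \<bullet> (?u - (Xs, 0))"
    using saddle_op_gap[OF ZK Xs_psd feasible, of 0 "w (T + 1)"] by simp
  also have "\<dots> \<le> \<rho> \<bullet> (?u - (Xs, 0))"
  proof -
    have "is_proj cone ((X T, y T) - saddle_op (X T, y T)) ?u" by (rule u_step[OF T])
    hence "d \<bullet> ((Xs, 0) - ?u) \<le> 0"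
      using Xs_psd unfolding is_proj_def d_def by blast
    hence "0 \<le> d \<bullet> (?u - (Xs, 0))" by (metis inner_minus_right minus_diff_eq neg_le_0_iff_le)
    thus ?thesis unfolding \<rho>_def inner_add_left by linarith
  qed
  also have "\<dots> \<le> norm \<rho> * norm (?u - (Xs, 0))" by (rule norm_cauchy_schwarz)
  also have "\<dots> \<le> (45 / 16 * S) * (23 / 24 * m)"
    by (intro mult_mono \<rho> \<open>norm (?u - (Xs, 0)) \<le> 23 / 24 * m\<close>) (use S in auto)
  \<comment> \<open>The product \<open>45/16 * 23/24\<close> is below 3.\<close>
  also have "\<dots> \<le> 3 * m * S" using mult_nonneg_nonneg[OF m S] by (simp add: mult.commute)
  finally have "\<eta> * (f (Z (T + 1)) - f Xs) \<le> R\<^sub>1 / sqrt (real T)" by (simp only: R1S)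
  hence "f (Z (T + 1)) - f Xs \<le> R\<^sub>1 / sqrt (real T) / \<eta>"
    by (simp only: pos_le_divide_eq[OF \<eta>_pos] mult.commute)
  thus "f (Z (T + 1)) - f Xs \<le> R\<^sub>1 / (\<eta> * sqrt (real T))"
    by (simp only: divide_divide_eq_left mult.commute)

  assume ys: "ys \<noteq> 0"
  have "snd \<rho> = \<eta> *\<^sub>R (lin_map A (Z (T + 1)) - b)"
    by (simp add: \<rho>_def d_snd saddle_op_Pair)
  hence "\<eta> * norm (lin_map A (Z (T + 1)) - b) = norm (snd \<rho>)" using \<eta>_pos by simp
  also have "\<dots> \<le> norm \<rho>" by (metis norm_snd_le prod.collapse)
  also note \<rho>
  finally have "norm ys * (\<eta> * norm (lin_map A (Z (T + 1)) - b)) \<le> norm ys * (45 / 16 * S)"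
    by (intro mult_left_mono) auto
  also have "\<dots> \<le> (m / 3) * (45 / 16 * S)"
    using S by (intro mult_right_mono) (auto simp: m_def)
  also have "\<dots> \<le> 3 * m * S" using mult_nonneg_nonneg[OF m S] by (simp add: mult.commute)
  finally have "norm ys * (\<eta> * norm (lin_map A (Z (T + 1)) - b)) \<le> R\<^sub>1 / sqrt (real T)"
    by (simp only: R1S)
  hence "norm (lin_map A (Z (T + 1)) - b) * (norm ys * \<eta>) \<le> R\<^sub>1 / sqrt (real T)"
    by (simp only: mult_ac)
  moreover have "0 < norm ys * \<eta>" using ys \<eta>_pos by simp
  ultimately have "norm (lin_map A (Z (T + 1)) - b) \<le> R\<^sub>1 / sqrt (real T) / (norm ys * \<eta>)"
    by (simp only: pos_le_divide_eq)
  thus "norm (lin_map A (Z (T + 1)) - b) \<le> R\<^sub>1 / (norm ys * \<eta> * sqrt (real T))"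
    by (simp only: divide_divide_eq_left mult_ac)
qed

end

text \<open>\<open>psd_proj\<close> determines its result. If at the points met by the exact run
  \<open>P\<close> returns only the exact projection, induction keeps both runs equal.\<close>

lemma extragradient_unique:
  assumes iff: "\<And>t Y. 1 \<le> t \<Longrightarrow> P (X t - \<eta> *\<^sub>R grad_X f A b (X t) (y t)) Y \<Longrightarrow>
                  psd_proj (X t - \<eta> *\<^sub>R grad_X f A b (X t) (y t)) Y"
      "\<And>t Y. 1 \<le> t \<Longrightarrow> P (X t - \<eta> *\<^sub>R grad_X f A b (Z (t + 1)) (w (t + 1))) Y \<Longrightarrow>
                  psd_proj (X t - \<eta> *\<^sub>R grad_X f A b (Z (t + 1)) (w (t + 1))) Y"
    and exact: "extragradient psd_proj f A b \<eta> X y Z w"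
    and other: "extragradient P f A b \<eta> X' y' Z' w'" and start: "X' 1 = X 1" "y' 1 = y 1"
  shows "(\<forall>t\<ge>1. X' t = X t \<and> y' t = y t) \<and> (\<forall>t\<ge>2. Z' t = Z t \<and> w' t = w t)"
proof -
  have Zw: "Z' (t + 1) = Z (t + 1) \<and> w' (t + 1) = w (t + 1)"
    if t: "1 \<le> t" and eq: "X' t = X t \<and> y' t = y t" for t
    using exact other t eq iff(1)[OF t, of "Z' (t + 1)"]
    unfolding extragradient_def psd_proj_def by metis
  have Xy: "X' t = X t \<and> y' t = y t" if "1 \<le> t" for t
    using that
  proof (induction t rule: dec_induct)
    case (step t)
    have "X' (t + 1) = X (t + 1) \<and> y' (t + 1) = y (t + 1)"
      using exact other step Zw[OF step(1,3)] iff(2)[OF step(1), of "X' (t + 1)"]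
      unfolding extragradient_def psd_proj_def by metis
    thus ?case by simp
  qed (use start in simp)
  moreover have "Z' t = Z t \<and> w' t = w t" if "2 \<le> t" for t
    using Zw[of "t - 1"] Xy[of "t - 1"] that by simp
  ultimately show ?thesis by blast
qed

text \<open>For a relational projection, replacing it without changing the sequences means two
  things: the exact run is a truncated run, and every truncated run from the same start, whatever
  eigen-decompositions it picks, is the exact run.\<close>

theorem theorem2p4:
  fixes f :: "real^'n^'n \<Rightarrow> real" and A :: "'m::finite \<Rightarrow> real^'n^'n" and b :: "real^'m"
    and \<beta> \<eta> R\<^sub>0 Rsq R\<^sub>1 :: real and r rt :: nat
    and Xs G :: "real^'n^'n" and ys :: "real^'m"
    and X Z :: "nat \<Rightarrow> real^'n^'n" and y w :: "nat \<Rightarrow> real^'m"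
  assumes f_convex: "convex_on sym_mats f"
    and f_smooth: "smooth_on \<beta> sym_mats f"
    and A_sym: "\<And>i. A i \<in> sym_mats"
    and slater: "\<exists>Xbar\<in>pd_mats. lin_map A Xbar = b"
    and bounded_below: "bdd_below (f ` feasible A b)"
    and optimal: "is_arg_min f (\<lambda>X'. X' \<in> feasible A b) Xs"
    and dual: "saddle_point f A b Xs ys"
    and G_def: "G = grad_X f A b Xs ys"
    and rt_def: "rt = CARD('n) - rank G"
    and \<eta>_pos: "0 < \<eta>"
    and \<eta>_le: "\<eta> \<le> 1 / sqrt (2 * (\<beta>\<^sup>2 + (lin_map_norm A)\<^sup>2))"
    and sequences: "extragradient psd_proj f A b \<eta> X y Z w"
    and r_ge: "rt \<le> r"
    and indices: "CARD('n) - r \<in> {1..CARD('n)}" "CARD('n) - r + rt - 1 \<in> {1..CARD('n)}"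
    and R0_def: "R\<^sub>0 =
      \<eta> * max (eigval G (CARD('n) - r)) (sqrt (real rt) * eigval G (CARD('n) - r + rt - 1))
      / (2 * (1 + sqrt 2 * \<eta> * max \<beta> (lin_map_norm A)))"
    and init: "norm ((X 1, y 1) - (Xs, ys)) \<le> R\<^sub>0"
    and Rsq_def: "Rsq = (norm (X 1 - Xs))\<^sup>2 +
      (SUP y'\<in>{y'. norm y' \<le> 2 * norm ys}. (norm (y 1 - y'))\<^sup>2)"
    and R1_def: "R\<^sub>1 =
      3 * sqrt 2 * max (2 * R\<^sub>0) (3 * norm ys) * norm ((X 1, y 1) - (Xs, ys))"
  shows
    "extragradient (trunc_psd_proj r) f A b \<eta> X y Z w \<and>
     (\<forall>X' y' Z' w'. extragradient (trunc_psd_proj r) f A b \<eta> X' y' Z' w' \<and> X' 1 = X 1 \<and> y' 1 = y 1 \<longrightarrow>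
        (\<forall>t\<ge>1. X' t = X t \<and> y' t = y t) \<and> (\<forall>t\<ge>2. Z' t = Z t \<and> w' t = w t)) \<and>
     (\<forall>T\<ge>1.
        f ((1 / real T) *\<^sub>R (\<Sum>t=1..T. Z (t + 1))) - f Xs \<le> Rsq / (2 * \<eta> * real T) \<and>
        (ys \<noteq> 0 \<longrightarrow> norm (lin_map A ((1 / real T) *\<^sub>R (\<Sum>t=1..T. Z (t + 1))) - b)
                      \<le> Rsq / (2 * norm ys * \<eta> * real T))) \<and>
     (\<eta> = 1 / (2 * sqrt (\<beta>\<^sup>2 + (lin_map_norm A)\<^sup>2)) \<longrightarrow>
        (\<forall>T\<ge>1.
           f (Z (T + 1)) - f Xs \<le> R\<^sub>1 / (\<eta> * sqrt (real T)) \<and>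
           (ys \<noteq> 0 \<longrightarrow> norm (lin_map A (Z (T + 1)) - b) \<le> R\<^sub>1 / (norm ys * \<eta> * sqrt (real T)))))"
proof -
  have feas: "lin_map A Xs = b" using optimal by (simp add: is_arg_min_def feasible_def)
  interpret psd_program_run f A b \<beta> \<eta> X Z y w Xs ys
    by unfold_locales (fact f_convex f_smooth A_sym \<eta>_pos \<eta>_le sequences dual feas)+
  have G: "G = Gs" unfolding G_def by (rule grad_X_df[OF psd_mats_imp_sym_mats[OF Xs_psd]])
  note iff = trunc_iff_proj[OF rt_def[unfolded G] r_ge indices R0_def[unfolded G] init]
  have iff1: "trunc_psd_proj r (X t - \<eta> *\<^sub>R grad_X f A b (X t) (y t)) Y
      \<longleftrightarrow> psd_proj (X t - \<eta> *\<^sub>R grad_X f A b (X t) (y t)) Y" if t: "1 \<le> t" for t Y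
  proof (rule iff[OF t X_psd[OF t]])
    have "norm ((X t, y t) - (Xs, ys)) \<le> dist1" by (rule dist_z[OF t])
    thus "norm ((X t, y t) - (Xs, ys)) \<le> 2 * dist1" using norm_ge_zero[of "(X 1, y 1) - (Xs, ys)"] by linarith
  qed
  have iff2: "trunc_psd_proj r (X t - \<eta> *\<^sub>R grad_X f A b (Z (t + 1)) (w (t + 1))) Y
      \<longleftrightarrow> psd_proj (X t - \<eta> *\<^sub>R grad_X f A b (Z (t + 1)) (w (t + 1))) Y" if t: "1 \<le> t" for t Y
    by (rule iff[OF t Z_psd[OF t] dist_u_le[OF t]])
  have trunc: "extragradient (trunc_psd_proj r) f A b \<eta> X y Z w"
    using sequences iff1 iff2 unfolding extragradient_def by blast
  have unique: "(\<forall>t\<ge>1. X' t = X t \<and> y' t = y t) \<and> (\<forall>t\<ge>2. Z' t = Z t \<and> w' t = w t)"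
    if "extragradient (trunc_psd_proj r) f A b \<eta> X' y' Z' w' \<and> X' 1 = X 1 \<and> y' 1 = y 1" for X' y' Z' w'
    using that iff1 iff2 by (intro extragradient_unique[where P = "trunc_psd_proj r", OF _ _ sequences]) blast+
  show ?thesis
    using trunc unique average_rate[OF _ Rsq_def] last_iterate_rate[OF _ _ init R1_def] by blast
qed

end
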